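(* Consider the online energy harvesting two-hop status update system described in the context, with service times $d>0$ (source–relay) and $\bar d>0$ (relay–destination). Under the best effort uniform update policy with service constraints, the long term average age satisfies $$\limsup_{T\to\infty}\frac{1}{T}\mathbb{E}[A_T]=\max\left\{\tfrac12+d+\bar d,\ \tfrac32(d+\bar d)\right\},$$ and this value equals the optimal value $\rho$; that is, the best effort uniform update policy with service constraints is optimal.
   Context: A source sends status updates to a destination through a half-duplex relay. Energy arrives at the source and at the relay according to two independent Poisson processes of unit rate. Each node has an infinite battery, and at time $0$ each battery holds exactly one energy packet. Transmitting one update consumes one energy packet at the transmitting node, and a node may transmit only if its battery holds at least one packet just before the transmission time (energy causality). An update transmitted by the source at time $t_i$ is generated at time $t_i$ and reaches the relay at time $t_i+d$. The relay forwards it at a time $\bar t_i\ge t_i+d$ (data causality), and it reaches the destination at time $\bar t_i+\bar d$. The source may transmit the next update only at a time $t_{i+1}\ge \bar t_i+\bar d$. Transmission decisions are made online by a central controller which, at each time, knows the energy arrivals at both nodes up to that time but not future arrivals. The age of information is $a(t)=t-u(t)$, where $u(t)$ is the generation time of the latest update received at the destination before time $t$, with $a(0)=0$. Let $A_T=\int_0^T a(t)\,dt$, and let $\rho$ be the minimum, over all such feasible online policies, of $\limsup_{T\to\infty}\frac1T\mathbb{E}[A_T]$. Best effort uniform update policy with service constraints: define scheduled times $\ell_n=n\max\{1,d+\bar d\}$ for $n=0,1,2,\dots$. At each $\ell_n$, the following rule applies. - If just before $\ell_n$ the source and the relay each have at least one energy packet, the source transmits a new update at $\ell_n$ and the relay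 forwards it immediately upon reception, at time $\ell_n+d$. - Otherwise, both nodes stay silent until $\ell_{n+1}$. *)

theory Defs
  imports "HOL-Probability.Probability" "HOL-Library.Extended_Nat"
begin

text \<open>Sample space: a pair of i.i.d. Exp(1) interarrival sequences
  (first component: source energy arrivals, second: relay energy arrivals).
  This realises two independent unit-rate Poisson processes.\<close>

type_synonym path = "(nat \<Rightarrow> real) \<times> (nat \<Rightarrow> real)"

definition exp1 :: "real measure" where
  "exp1 = density lborel (exponential_density 1)"

definition Omega :: "path measure" where
  "Omega = (PiM UNIV (\<lambda>_. exp1)) \<Otimes>\<^sub>M (PiM UNIV (\<lambda>_. exp1))"

definition arr_time :: "(nat \<Rightarrow> real) \<Rightarrow> nat \<Rightarrow> real" where
  "arr_time X k = (\<Sum>j\<le>k. X j)"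

definition N_upto :: "(nat \<Rightarrow> real) \<Rightarrow> real \<Rightarrow> enat" where
  "N_upto X s = (let A = {k. arr_time X k \<le> s} in if finite A then enat (card A) else \<infinity>)"

definition N_before :: "(nat \<Rightarrow> real) \<Rightarrow> real \<Rightarrow> enat" where
  "N_before X s = (let A = {k. arr_time X k < s} in if finite A then enat (card A) else \<infinity>)"

text \<open>A schedule: source transmission times t i and relay forwarding times tb i
  of the i-th update (i = 0, 1, ...); the value \<infinity> means the update is never sent.
  A (deterministic) policy maps the arrival sample path to a schedule.\<close>

type_synonym schedule = "(nat \<Rightarrow> ereal) \<times> (nat \<Rightarrow> ereal)"
type_synonym policy = "path \<Rightarrow> schedule"

definition online :: "policy \<Rightarrow> bool" where
  "online \<pi> \<longleftrightarrow>
    (\<forall>s \<omega> \<omega>'. (\<forall>r\<le>s. N_upto (fst \<omega>) r = N_upto (fst \<omega>') r \<and> N_upto (snd \<omega>) r = N_upto (snd \<omega>') r)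
       \<longrightarrow> (\<forall>i. (fst (\<pi> \<omega>) i \<le> ereal s \<longleftrightarrow> fst (\<pi> \<omega>') i \<le> ereal s)
              \<and> (fst (\<pi> \<omega>) i \<le> ereal s \<longrightarrow> fst (\<pi> \<omega>) i = fst (\<pi> \<omega>') i)
              \<and> (snd (\<pi> \<omega>) i \<le> ereal s \<longleftrightarrow> snd (\<pi> \<omega>') i \<le> ereal s)
              \<and> (snd (\<pi> \<omega>) i \<le> ereal s \<longrightarrow> snd (\<pi> \<omega>) i = snd (\<pi> \<omega>') i)))"

text \<open>Feasibility on every sample path: data causality, service constraints, energy
  causality (the i-th transmission of a node, i counted from 0, needs
  1 + (arrivals strictly before) - i \<ge> 1 packets), plus online and measurability.\<close>
definition feasible_sched :: "real \<Rightarrow> real \<Rightarrow> path \<Rightarrow> schedule \<Rightarrow> bool" where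
  "feasible_sched d db \<omega> S \<longleftrightarrow>
     0 \<le> fst S 0 \<and>
     (\<forall>i. fst S i + ereal d \<le> snd S i \<and> snd S i + ereal db \<le> fst S (Suc i)) \<and>
     (\<forall>i. fst S i \<noteq> \<infinity> \<longrightarrow> enat i \<le> N_before (fst \<omega>) (real_of_ereal (fst S i))) \<and>
     (\<forall>i. snd S i \<noteq> \<infinity> \<longrightarrow> enat i \<le> N_before (snd \<omega>) (real_of_ereal (snd S i)))"

definition feasible :: "real \<Rightarrow> real \<Rightarrow> policy \<Rightarrow> bool" where
  "feasible d db \<pi> \<longleftrightarrow>
     (\<forall>\<omega>. feasible_sched d db \<omega> (\<pi> \<omega>)) \<and> online \<pi> \<and>
     (\<forall>i. (\<lambda>\<omega>. fst (\<pi> \<omega>) i) \<in> borel_measurable Omega \<and> (\<lambda>\<omega>. snd (\<pi> \<omega>) i) \<in> borel_measurable Omega)"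

text \<open>Generation time of the latest update received at the destination before time s
  (0 if none yet, so that a(0) = 0); age and accumulated age.\<close>
definition upd_gen :: "real \<Rightarrow> schedule \<Rightarrow> real \<Rightarrow> real" where
  "upd_gen db S s = Sup ({0} \<union> {real_of_ereal (fst S i) | i. snd S i + ereal db < ereal s})"

definition age :: "real \<Rightarrow> schedule \<Rightarrow> real \<Rightarrow> real" where
  "age db S s = s - upd_gen db S s"

definition area :: "real \<Rightarrow> schedule \<Rightarrow> real \<Rightarrow> ennreal" where
  "area db S T = (\<integral>\<^sup>+ s. ennreal (age db S s) * indicator {0..T} s \<partial>lborel)"

definition avg_age :: "real \<Rightarrow> policy \<Rightarrow> ennreal" where
  "avg_age db \<pi> = Limsup at_top (\<lambda>T::real. (\<integral>\<^sup>+ \<omega>. area db (\<pi> \<omega>) T \<partial>Omega) / ennreal T)"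

definition rho :: "real \<Rightarrow> real \<Rightarrow> ennreal" where
  "rho d db = (INF \<pi> \<in> {\<pi>. feasible d db \<pi>}. avg_age db \<pi>)"

text \<open>Best effort uniform update policy with service constraints.
  beu_cnt p \<omega> n = number of updates sent at the scheduled times l_0,...,l_{n-1},
  where l_m = m * p and p = max 1 (d + db). At l_n an update is sent iff both
  batteries hold a packet just before l_n.\<close>
fun beu_cnt :: "real \<Rightarrow> path \<Rightarrow> nat \<Rightarrow> nat" where
  "beu_cnt p \<omega> 0 = 0"
| "beu_cnt p \<omega> (Suc n) =
     (let c = beu_cnt p \<omega> n in
      if enat c \<le> N_before (fst \<omega>) (real n * p) \<and> enat c \<le> N_before (snd \<omega>) (real n * p)
      then Suc c else c)"

definition beu_fire :: "real \<Rightarrow> path \<Rightarrow> nat \<Rightarrow> bool" where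
  "beu_fire p \<omega> n \<longleftrightarrow> beu_cnt p \<omega> (Suc n) = Suc (beu_cnt p \<omega> n)"

definition beu_policy :: "real \<Rightarrow> real \<Rightarrow> policy" where
  "beu_policy d db \<omega> =
     (let p = max 1 (d + db);
          t = (\<lambda>i. if \<exists>n. beu_fire p \<omega> n \<and> beu_cnt p \<omega> n = i
                   then ereal (real (LEAST n. beu_fire p \<omega> n \<and> beu_cnt p \<omega> n = i) * p)
                   else \<infinity>)
      in (t, \<lambda>i. t i + ereal d))"

end

theory Submission
  imports Defs
begin

text \<open>
  Write \<open>D = d + db\<close> and \<open>p = max 1 D\<close>, so that the claimed value is \<open>D + p/2\<close>.

  Lower bound. The age at time \<open>s\<close> is at least \<open>D\<close> plus the time from the last transmission before
  \<open>s - D\<close> to \<open>s - D\<close>. With at most \<open>n\<close> transmissions up to \<open>x = T - D\<close>, convexity of the square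
  bounds the area below by \<open>D * x\<close> plus roughly \<open>c * x - n * c^2/2\<close> for every \<open>c\<close>. The service
  constraint gives \<open>n \<le> x/D + 1\<close> (take \<open>c = D\<close>), and energy causality with the weak law of large numbers
  gives \<open>n \<le> (1 + \<eta>) * x\<close> with high probability (take \<open>c = 1\<close>).

  Upper bound. The excess age of the best effort policy is governed by the number of slots since the
  last transmission. If this number is at least \<open>r\<close>, then one of the two nodes has received no energy
  during the last \<open>r\<close> slots, which has probability at most \<open>2 * exp (- r)\<close>. The expected number of
  silent slots among the first \<open>n\<close> is \<open>o(n)\<close>, since it is controlled by the maximal deviation of the
  arrival times from their means. Together these make the average excess vanish.
\<close>

section \<open>The arrival processes\<close>

definition gaps :: "(nat \<Rightarrow> real) measure" where
  "gaps = PiM UNIV (\<lambda>_. exp1)"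

lemma Omega_eq: "Omega = gaps \<Otimes>\<^sub>M gaps"
  by (simp add: Omega_def gaps_def)

lemma prob_space_exp1: "prob_space exp1"
  unfolding exp1_def by (rule prob_space_exponential_density) simp

lemma sets_exp1 [measurable_cong, simp]: "sets exp1 = sets borel"
  by (simp add: exp1_def)

lemma space_exp1 [simp]: "space exp1 = UNIV"
  by (simp add: exp1_def)

lemma space_gaps [simp]: "space gaps = UNIV"
  by (simp add: gaps_def space_PiM)

lemma sets_gaps [measurable_cong]: "sets gaps = sets (PiM UNIV (\<lambda>_. borel))"
  unfolding gaps_def by (rule sets_PiM_cong) simp_all

lemma measurable_gap [measurable]: "(\<lambda>\<omega>. \<omega> i) \<in> borel_measurable gaps"
  unfolding gaps_def using measurable_component_singleton[of i UNIV "\<lambda>_. exp1"] by simp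

lemma measurable_arr_time [measurable]: "(\<lambda>\<omega>. arr_time \<omega> k) \<in> borel_measurable gaps"
  unfolding arr_time_def by measurable

interpretation gaps: prob_space gaps
  unfolding gaps_def by (intro prob_space_PiM prob_space_exp1)

interpretation Omega: prob_space Omega
  unfolding Omega_eq by (rule prob_space_pair) unfold_locales

lemma space_Omega [simp]: "space Omega = UNIV"
  by (simp add: Omega_eq space_pair_measure)

lemma measurable_fst_Omega [measurable]: "fst \<in> Omega \<rightarrow>\<^sub>M gaps"
  unfolding Omega_eq by measurable

lemma measurable_snd_Omega [measurable]: "snd \<in> Omega \<rightarrow>\<^sub>M gaps"
  unfolding Omega_eq by measurable

lemma nn_integral_Omega_fst:
  assumes [measurable]: "f \<in> borel_measurable gaps"
  shows "(\<integral>\<^sup>+\<omega>. f (fst \<omega>) \<partial>Omega) = (\<integral>\<^sup>+x. f x \<partial>gaps)"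
  unfolding Omega_eq
  by (subst gaps.nn_integral_fst[symmetric]) (auto simp: gaps.emeasure_space_1[simplified])

lemma nn_integral_Omega_snd:
  assumes [measurable]: "f \<in> borel_measurable gaps"
  shows "(\<integral>\<^sup>+\<omega>. f (snd \<omega>) \<partial>Omega) = (\<integral>\<^sup>+x. f x \<partial>gaps)"
  unfolding Omega_eq
  by (subst gaps.nn_integral_fst[symmetric]) (auto simp: gaps.emeasure_space_1[simplified])

lemma distr_gap: "distr gaps exp1 (\<lambda>\<omega>. \<omega> i) = exp1"
  unfolding gaps_def by (rule distr_PiM_component) (auto simp: prob_space_exp1)

lemma distributed_gap: "distributed gaps lborel (\<lambda>\<omega>. \<omega> i) (exponential_density 1)"
proof -
  have "distr gaps lborel (\<lambda>\<omega>. \<omega> i) = distr gaps exp1 (\<lambda>\<omega>. \<omega> i)"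
    by (rule distr_cong) simp_all
  also have "\<dots> = exp1"
    by (rule distr_gap)
  finally show ?thesis
    unfolding distributed_def by (auto simp: exp1_def)
qed

lemma indep_gaps: "gaps.indep_vars (\<lambda>_. borel) (\<lambda>i \<omega>. \<omega> i) UNIV"
proof -
  have "gaps.indep_vars (\<lambda>_. exp1) (\<lambda>i \<omega>. \<omega> i) UNIV"
  proof (subst gaps.indep_vars_iff_distr_eq_PiM')
    show "distr gaps (PiM UNIV (\<lambda>_. exp1)) (\<lambda>x. \<lambda>i\<in>UNIV. x i) = PiM UNIV (\<lambda>i. distr gaps exp1 (\<lambda>\<omega>. \<omega> i))"
      unfolding distr_gap by (simp add: gaps_def restrict_UNIV distr_id)
  qed (auto simp: measurable_cong_sets[OF refl sets_exp1])
  then show ?thesis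
    unfolding gaps.indep_vars_def by simp
qed

text \<open>Arrival \<open>k\<close> is the sum of the \<open>k + 1\<close> gaps with indices up to
  \<open>k\<close>, and \<open>erlang_density k\<close> is the density for \<open>k + 1\<close>
  exponential stages, so the two indices agree.\<close>

lemma distributed_arr_time: "distributed gaps lborel (\<lambda>\<omega>. arr_time \<omega> k) (erlang_density k 1)"
  unfolding arr_time_def
  using gaps.exponential_distributed_sum[of "{..k}" 1 "\<lambda>i \<omega>. \<omega> i"] distributed_gap
    gaps.indep_vars_subset[OF indep_gaps, of "{..k}"]
  by auto

section \<open>Moments and deviations of the arrival times\<close>

lemma fact_quotients:
  "fact (k + 1) / fact k = (real k + 1 :: real)"
  "fact (k + 2) / fact k = ((real k + 1) * (real k + 2) :: real)"
  "fact (k + 3) / fact k = ((real k + 1) * (real k + 2) * (real k + 3) :: real)"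
  "fact (k + 4) / fact k = ((real k + 1) * (real k + 2) * (real k + 3) * (real k + 4) :: real)"
  by (simp_all add: eval_nat_numeral field_simps)

text \<open>Binomial expansion with the raw Erlang moments \<open>fact (k + i) / fact k\<close>. The
  fourth moment is taken because a union bound over \<open>n\<close> arrivals follows, with
  deviations proportional to \<open>n\<close>: the variance would give a bound of order 1 there, the
  fourth moment gives one of order 1/n.\<close>

lemma arr_time_fourth_central_moment:
  defines "n \<equiv> \<lambda>k. real (Suc k)"
  shows "has_bochner_integral gaps (\<lambda>\<omega>. (arr_time \<omega> k - n k) ^ 4) (3 * n k ^ 2 + 6 * n k)"
proof -
  have m: "has_bochner_integral gaps (\<lambda>\<omega>. arr_time \<omega> k ^ i) (fact (k + i) / fact k)" for i
    using gaps.has_bochner_integral_erlang_ith_moment[OF _ distributed_arr_time, of k i] by simp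
  have "has_bochner_integral gaps
      (\<lambda>\<omega>. arr_time \<omega> k ^ 4 - 4 * n k * arr_time \<omega> k ^ 3 + 6 * n k ^ 2 * arr_time \<omega> k ^ 2
         - 4 * n k ^ 3 * arr_time \<omega> k ^ 1 + n k ^ 4 * arr_time \<omega> k ^ 0)
      (fact (k + 4) / fact k - 4 * n k * (fact (k + 3) / fact k)
         + 6 * n k ^ 2 * (fact (k + 2) / fact k) - 4 * n k ^ 3 * (fact (k + 1) / fact k)
         + n k ^ 4 * (fact (k + 0) / fact k))"
    by (intro has_bochner_integral_add has_bochner_integral_diff has_bochner_integral_mult_right m)
  moreover have "arr_time \<omega> k ^ 4 - 4 * n k * arr_time \<omega> k ^ 3 + 6 * n k ^ 2 * arr_time \<omega> k ^ 2
         - 4 * n k ^ 3 * arr_time \<omega> k ^ 1 + n k ^ 4 * arr_time \<omega> k ^ 0 = (arr_time \<omega> k - n k) ^ 4" for \<omega>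
    by (simp add: eval_nat_numeral algebra_simps)
  moreover have "fact (k + 4) / fact k - 4 * n k * (fact (k + 3) / fact k)
         + 6 * n k ^ 2 * (fact (k + 2) / fact k) - 4 * n k ^ 3 * (fact (k + 1) / fact k)
         + n k ^ 4 * (fact (k + 0) / fact k) = 3 * n k ^ 2 + 6 * n k"
    unfolding fact_quotients n_def by (simp add: eval_nat_numeral algebra_simps)
  ultimately show ?thesis
    by simp
qed

text \<open>Markov's inequality for the fourth power. The constant 9 absorbs the linear term, since
  3 n^2 + 6 n \<le> 9 n^2 for n \<ge> 1.\<close>

lemma arr_time_deviation:
  assumes "0 < \<delta>"
  shows "emeasure gaps {\<omega>. \<delta> \<le> \<bar>arr_time \<omega> k - real (Suc k)\<bar>} \<le> ennreal (9 * real (Suc k) ^ 2 / \<delta> ^ 4)"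
proof -
  let ?n = "real (Suc k)"
  have "{\<omega>. \<delta> \<le> \<bar>arr_time \<omega> k - ?n\<bar>} \<subseteq> {\<omega>\<in>space gaps. \<delta> ^ 4 \<le> (arr_time \<omega> k - ?n) ^ 4}"
  proof safe
    fix \<omega> assume "\<delta> \<le> \<bar>arr_time \<omega> k - ?n\<bar>"
    then have "\<delta> ^ 4 \<le> \<bar>arr_time \<omega> k - ?n\<bar> ^ 4"
      using assms by (intro power_mono) auto
    then show "\<delta> ^ 4 \<le> (arr_time \<omega> k - ?n) ^ 4"
      by (simp add: power_even_abs)
  qed simp
  then have "emeasure gaps {\<omega>. \<delta> \<le> \<bar>arr_time \<omega> k - ?n\<bar>}
      \<le> emeasure gaps {\<omega>\<in>space gaps. \<delta> ^ 4 \<le> (arr_time \<omega> k - ?n) ^ 4}"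
    by (intro emeasure_mono) measurable
  also have "\<dots> \<le> ennreal ((\<integral>\<omega>. (arr_time \<omega> k - ?n) ^ 4 \<partial>gaps) / \<delta> ^ 4)"
    using arr_time_fourth_central_moment[of k] assms
    by (subst gaps.emeasure_eq_measure, intro ennreal_leI integral_Markov_inequality_measure[where A="{}"])
       (auto simp: has_bochner_integral_iff)
  also have "\<dots> \<le> ennreal (9 * ?n ^ 2 / \<delta> ^ 4)"
    using arr_time_fourth_central_moment[of k] assms
    by (intro ennreal_leI divide_right_mono) (auto simp: has_bochner_integral_iff power2_eq_square algebra_simps)
  finally show ?thesis .
qed

lemma AE_gaps_nonneg: "AE \<omega> in gaps. \<forall>i. 0 \<le> \<omega> i"
proof (subst AE_all_countable, rule allI)
  fix i
  have "AE x in exp1. 0 \<le> x"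
    unfolding exp1_def by (subst AE_density) (auto simp: exponential_density_def)
  then show "AE \<omega> in gaps. 0 \<le> \<omega> i"
    unfolding gaps_def by (intro AE_PiM_component prob_space_exp1) auto
qed

lemma emeasure_exp1_atLeast:
  assumes "0 \<le> u"
  shows "emeasure exp1 {u..} = ennreal (exp (- u))"
proof -
  have D: "distributed exp1 lborel (\<lambda>x. x) (exponential_density 1)"
    unfolding distributed_def by (auto simp: exp1_def distr_id2)
  \<comment> \<open>The exponential tail formula used below concerns the open ray, so the endpoint
    has to be a null set.\<close>
  have "emeasure exp1 {u} = 0"
    unfolding exp1_def by (subst emeasure_density) (auto simp: nn_integral_null_set AE_iff_null_sets
       intro!: nn_integral_0_iff_AE[THEN iffD2] AE_I[where N="{u}"] split: split_indicator)
  have "emeasure exp1 {u..} = emeasure exp1 ({u} \<union> {u<..})"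
    by (rule arg_cong[where f="emeasure exp1"]) auto
  also have "\<dots> = emeasure exp1 {u<..}"
    using \<open>emeasure exp1 {u} = 0\<close> by (subst plus_emeasure[symmetric]) auto
  also have "\<dots> = ennreal (exp (- u))"
    using prob_space.exponential_distributedD_gt[OF prob_space_exp1 D assms]
    by (simp add: finite_measure.emeasure_eq_measure[OF prob_space.finite_measure[OF prob_space_exp1]]
        greaterThan_def)
  finally show ?thesis .
qed

section \<open>Intervals without arrivals and memorylessness\<close>

text \<open>For nondecreasing arrival times tending to infinity and \<open>a \<le> b\<close>, this
  is the event of no arrival in [a, b). Naming the index \<open>m\<close> of the first arrival not
  before \<open>a\<close> splits the event into pieces in which gap \<open>m\<close> is independent
  of the gaps before it.\<close>

definition idle :: "real \<Rightarrow> real \<Rightarrow> (nat \<Rightarrow> real) set" where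
  "idle a b = {\<omega>. \<exists>m. (\<forall>l<m. arr_time \<omega> l < a) \<and> b \<le> arr_time \<omega> m}"

lemma idle_sets [measurable]: "idle a b \<in> sets gaps"
proof -
  have "{\<omega> \<in> space gaps. \<exists>m. (\<forall>l<m. arr_time \<omega> l < a) \<and> b \<le> arr_time \<omega> m} \<in> sets gaps"
    by measurable
  then show ?thesis
    by (simp add: idle_def)
qed

text \<open>Restart at a fixed index: continuing the first \<open>m\<close> gaps of one copy with an
  independent second copy leaves the law unchanged.\<close>

lemma distr_comb_seq: "distr (gaps \<Otimes>\<^sub>M gaps) gaps (\<lambda>(\<omega>, \<omega>'). comb_seq m \<omega> \<omega>') = gaps"
proof -
  interpret sequence_space exp1
    by (intro sequence_space.intro product_prob_spaceI prob_space_exp1)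
  show ?thesis
    unfolding gaps_def by (rule PiM_comb_seq)
qed

lemma measurable_comb_seq_gaps: "(\<lambda>(\<omega>, \<omega>'). comb_seq m \<omega> \<omega>') \<in> gaps \<Otimes>\<^sub>M gaps \<rightarrow>\<^sub>M gaps"
  unfolding gaps_def by (rule measurable_comb_seq)

lemma arr_time_comb_seq:
  "l < m \<Longrightarrow> arr_time (comb_seq m \<omega> \<omega>') l = arr_time \<omega> l"
  "arr_time (comb_seq m \<omega> \<omega>') m = (\<Sum>j<m. \<omega> j) + \<omega>' 0"
proof -
  show "l < m \<Longrightarrow> arr_time (comb_seq m \<omega> \<omega>') l = arr_time \<omega> l"
    unfolding arr_time_def by (intro sum.cong) (auto simp: comb_seq_less)
  have "arr_time (comb_seq m \<omega> \<omega>') m = (\<Sum>j<m. comb_seq m \<omega> \<omega>' j) + comb_seq m \<omega> \<omega>' (0 + m)"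
    unfolding arr_time_def by (simp add: lessThan_Suc_atMost[symmetric])
  also have "\<dots> = (\<Sum>j<m. \<omega> j) + \<omega>' 0"
    by (simp only: comb_seq_add) (simp add: comb_seq_less)
  finally show "arr_time (comb_seq m \<omega> \<omega>') m = (\<Sum>j<m. \<omega> j) + \<omega>' 0" .
qed

text \<open>Conditions on the first \<open>m\<close> gaps. Gap \<open>m\<close> is then a fresh
  exponential variable that has to cover the remaining time up to \<open>u\<close>.\<close>

lemma emeasure_first_passage:
  assumes "0 \<le> a" "a \<le> u"
  shows "emeasure gaps {\<omega>. (\<forall>l<m. arr_time \<omega> l < a) \<and> u \<le> arr_time \<omega> m} =
    (\<integral>\<^sup>+\<omega>. indicator {\<omega>. \<forall>l<m. arr_time \<omega> l < a} \<omega> * ennreal (exp (- (u - (\<Sum>j<m. \<omega> j)))) \<partial>gaps)"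
    (is "emeasure gaps ?A = _")
proof -
  have "{\<omega>\<in>space gaps. (\<forall>l<m. arr_time \<omega> l < a) \<and> u \<le> arr_time \<omega> m} \<in> sets gaps"
    by measurable
  then have [measurable]: "?A \<in> sets gaps"
    by simp
  have [measurable]: "(\<lambda>(\<omega>, \<omega>'). comb_seq m \<omega> \<omega>') \<in> gaps \<Otimes>\<^sub>M gaps \<rightarrow>\<^sub>M gaps"
    by (rule measurable_comb_seq_gaps)
  \<comment> \<open>The remaining time to \<open>u\<close> is nonnegative on the event, as the
    exponential tail formula demands; for \<open>m = 0\<close> this rests on
    \<open>0 \<le> a\<close>.\<close>
  have past: "(\<Sum>j<m. \<omega> j) \<le> a" if "\<forall>l<m. arr_time \<omega> l < a" for \<omega>
  proof (cases m)
    case (Suc k)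
    then have "arr_time \<omega> k < a" using that by auto
    then show ?thesis
      by (simp add: Suc arr_time_def lessThan_Suc_atMost)
  qed (use assms in simp)
  have "emeasure gaps ?A = (\<integral>\<^sup>+x. indicator ?A x \<partial>gaps)"
    by simp
  also have "\<dots> = (\<integral>\<^sup>+x. indicator ?A x \<partial>distr (gaps \<Otimes>\<^sub>M gaps) gaps (\<lambda>(\<omega>, \<omega>'). comb_seq m \<omega> \<omega>'))"
    by (simp only: distr_comb_seq)
  also have "\<dots> = (\<integral>\<^sup>+x. indicator ?A (case x of (\<omega>, \<omega>') \<Rightarrow> comb_seq m \<omega> \<omega>') \<partial>(gaps \<Otimes>\<^sub>M gaps))"
    by (subst nn_integral_distr) auto
  also have "\<dots> = (\<integral>\<^sup>+\<omega>. \<integral>\<^sup>+\<omega>'. indicator ?A (comb_seq m \<omega> \<omega>') \<partial>gaps \<partial>gaps)"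
    by (subst gaps.nn_integral_fst[symmetric]) auto
  also have "\<dots> = (\<integral>\<^sup>+\<omega>. indicator {\<omega>. \<forall>l<m. arr_time \<omega> l < a} \<omega> *
      ennreal (exp (- (u - (\<Sum>j<m. \<omega> j)))) \<partial>gaps)"
  proof (intro nn_integral_cong)
    fix \<omega> :: "nat \<Rightarrow> real"
    show "(\<integral>\<^sup>+\<omega>'. indicator ?A (comb_seq m \<omega> \<omega>') \<partial>gaps) =
      indicator {\<omega>. \<forall>l<m. arr_time \<omega> l < a} \<omega> * ennreal (exp (- (u - (\<Sum>j<m. \<omega> j))))"
    proof (cases "\<forall>l<m. arr_time \<omega> l < a")
      case True
      let ?v = "u - (\<Sum>j<m. \<omega> j)"
      \<comment> \<open>With the first \<open>m\<close> gaps fixed and all earlier arrivals before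
        \<open>a\<close>, the event only says that the fresh gap is at least
        \<open>?v\<close>.\<close>
      have "(\<integral>\<^sup>+\<omega>'. indicator ?A (comb_seq m \<omega> \<omega>') \<partial>gaps) = (\<integral>\<^sup>+\<omega>'. indicator {?v..} (\<omega>' 0) \<partial>gaps)"
        using True by (intro nn_integral_cong) (auto simp: indicator_def arr_time_comb_seq)
      also have "\<dots> = (\<integral>\<^sup>+x. indicator {?v..} x \<partial>distr gaps exp1 (\<lambda>\<omega>. \<omega> 0))"
        by (subst nn_integral_distr) (auto intro!: borel_measurable_indicator)
      also have "\<dots> = ennreal (exp (- ?v))"
        using past[OF True] assms by (simp add: distr_gap emeasure_exp1_atLeast)
      finally show ?thesis
        using True by simp
    next
      case False
      then have "indicator ?A (comb_seq m \<omega> \<omega>') = (0 :: ennreal)" for \<omega>'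
        by (auto simp: indicator_def arr_time_comb_seq)
      with False show ?thesis
        by simp
    qed
  qed
  finally show ?thesis .
qed

text \<open>Memorylessness at the first arrival after \<open>a\<close>, whose index is summed over.\<close>

lemma emeasure_idle:
  assumes "0 \<le> a" "a \<le> b"
  shows "emeasure gaps (idle a b) \<le> ennreal (exp (- (b - a)))"
proof -
  define A where "A u m = {\<omega>. (\<forall>l<m. arr_time \<omega> l < a) \<and> u \<le> arr_time \<omega> m}" for u m
  have "{\<omega>\<in>space gaps. (\<forall>l<m. arr_time \<omega> l < a) \<and> u \<le> arr_time \<omega> m} \<in> sets gaps" for u m
    by measurable
  then have [measurable]: "A u m \<in> sets gaps" for u m
    by (simp add: A_def)
  \<comment> \<open>The first-passage integrands for \<open>b\<close> and for \<open>a\<close>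
    differ by the constant factor exp (a - b).\<close>
  have *: "emeasure gaps (A b m) = ennreal (exp (- (b - a))) * emeasure gaps (A a m)" for m
  proof -
    have "{\<omega>\<in>space gaps. \<forall>l<m. arr_time \<omega> l < a} \<in> sets gaps"
      by measurable
    then have [measurable]: "{\<omega>. \<forall>l<m. arr_time \<omega> l < a} \<in> sets gaps"
      by simp
    have "emeasure gaps (A b m) = (\<integral>\<^sup>+\<omega>. ennreal (exp (- (b - a))) *
       (indicator {\<omega>. \<forall>l<m. arr_time \<omega> l < a} \<omega> * ennreal (exp (- (a - (\<Sum>j<m. \<omega> j))))) \<partial>gaps)"
      unfolding A_def emeasure_first_passage[OF assms]
    proof (intro nn_integral_cong)
      fix \<omega> :: "nat \<Rightarrow> real"
      have "exp (- (b - (\<Sum>j<m. \<omega> j))) = exp (- (b - a)) * exp (- (a - (\<Sum>j<m. \<omega> j)))"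
        by (simp add: exp_add[symmetric])
      then show "indicator {\<omega>. \<forall>l<m. arr_time \<omega> l < a} \<omega> * ennreal (exp (- (b - (\<Sum>j<m. \<omega> j)))) =
        ennreal (exp (- (b - a))) *
        (indicator {\<omega>. \<forall>l<m. arr_time \<omega> l < a} \<omega> * ennreal (exp (- (a - (\<Sum>j<m. \<omega> j)))))"
        by (simp add: ennreal_mult mult_ac)
    qed
    also have "\<dots> = ennreal (exp (- (b - a))) * emeasure gaps (A a m)"
      unfolding A_def emeasure_first_passage[OF assms(1) order_refl]
      by (rule nn_integral_cmult) measurable
    finally show ?thesis .
  qed
  \<comment> \<open>In \<open>A a m\<close> the index \<open>m\<close> is the first one that does
    not arrive before \<open>a\<close>, so distinct \<open>m\<close> exclude each other and the
    probabilities sum to at most 1.\<close>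
  have disj: "disjoint_family (A a)"
    unfolding disjoint_family_on_def A_def by (force simp: linorder_neq_iff)
  have "idle a b = (\<Union>m. A b m)"
    by (auto simp: idle_def A_def)
  then have "emeasure gaps (idle a b) \<le> (\<Sum>m. emeasure gaps (A b m))"
    by (auto intro!: emeasure_subadditive_countably)
  also have "\<dots> = ennreal (exp (- (b - a))) * (\<Sum>m. emeasure gaps (A a m))"
    by (simp add: *)
  also have "\<dots> = ennreal (exp (- (b - a))) * emeasure gaps (\<Union>m. A a m)"
    using disj by (subst suminf_emeasure) auto
  also have "\<dots> \<le> ennreal (exp (- (b - a))) * 1"
    by (intro mult_left_mono gaps.emeasure_le_1) auto
  finally show ?thesis
    by simp
qed

section \<open>The counting processes\<close>

text \<open>Finite witness sets treat both branches of the arrival counts alike, including paths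
  with infinitely many arrivals in bounded time.\<close>

lemma enat_le_card_iff:
  "enat c \<le> (if finite A then enat (card A) else \<infinity>) \<longleftrightarrow> (\<exists>F. finite F \<and> card F = c \<and> F \<subseteq> A)"
proof (cases "finite A")
  case True
  then show ?thesis
    by (auto intro: card_mono dest: obtain_subset_with_card_n)
next
  case False
  then show ?thesis
    using infinite_arbitrarily_large[OF False, of c] by auto
qed

lemma enat_le_N_before_iff:
  "enat c \<le> N_before X s \<longleftrightarrow> (\<exists>F. finite F \<and> card F = c \<and> (\<forall>k\<in>F. arr_time X k < s))"
  unfolding N_before_def Let_def enat_le_card_iff by (auto simp: subset_iff)

lemma enat_le_N_upto_iff:
  "enat c \<le> N_upto X s \<longleftrightarrow> (\<exists>F. finite F \<and> card F = c \<and> (\<forall>k\<in>F. arr_time X k \<le> s))"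
  unfolding N_upto_def Let_def enat_le_card_iff by (auto simp: subset_iff)

lemma enat_le_N_before_mono:
  "enat c \<le> N_before X s \<Longrightarrow> s \<le> t \<Longrightarrow> enat c \<le> N_before X t"
  unfolding enat_le_N_before_iff by (elim exE conjE, intro exI conjI ballI) (auto intro: less_le_trans)

text \<open>Connects the two ways of counting: energy causality looks strictly before
  \<open>s\<close>, whereas \<open>online\<close> compares counts up to and including a
  time.\<close>

lemma enat_le_N_before_iff_N_upto:
  "enat c \<le> N_before X s \<longleftrightarrow> (\<exists>r<s. enat c \<le> N_upto X r)"
proof
  assume "enat c \<le> N_before X s"
  then obtain F where F: "finite F" "card F = c" "\<forall>k\<in>F. arr_time X k < s"
    by (auto simp: enat_le_N_before_iff)
  \<comment> \<open>The last arrival among the finitely many witnesses; \<open>s - 1\<close>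
    provides a value below \<open>s\<close> when there is none.\<close>
  define r where "r = Max (insert (s - 1) (arr_time X ` F))"
  have "r < s" "\<forall>k\<in>F. arr_time X k \<le> r"
    using F by (auto simp: r_def)
  with F show "\<exists>r<s. enat c \<le> N_upto X r"
    by (auto simp: enat_le_N_upto_iff)
next
  assume "\<exists>r<s. enat c \<le> N_upto X r"
  then show "enat c \<le> N_before X s"
    unfolding enat_le_N_upto_iff enat_le_N_before_iff
    by (elim exE conjE, intro exI conjI ballI) (auto intro: le_less_trans)
qed

text \<open>Distinct lists replace finite sets because lists of naturals form a countable type, so
  that the existential quantifier is a countable union.\<close>

lemma pred_enat_le_N_before:
  assumes [measurable]: "f \<in> M \<rightarrow>\<^sub>M gaps"
  shows "Measurable.pred M (\<lambda>\<omega>. enat c \<le> N_before (f \<omega>) s)"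
proof -
  have "enat c \<le> N_before X s \<longleftrightarrow>
      (\<exists>xs. (distinct xs \<and> length xs = c) \<and> (\<forall>k\<in>set xs. arr_time X k < s))" for X
  proof
    assume "enat c \<le> N_before X s"
    then obtain F where "finite F" "card F = c" "\<forall>k\<in>F. arr_time X k < s"
      by (auto simp: enat_le_N_before_iff)
    then show "\<exists>xs. (distinct xs \<and> length xs = c) \<and> (\<forall>k\<in>set xs. arr_time X k < s)"
      using finite_distinct_list[of F] distinct_card by metis
  next
    assume "\<exists>xs. (distinct xs \<and> length xs = c) \<and> (\<forall>k\<in>set xs. arr_time X k < s)"
    then show "enat c \<le> N_before X s"
      unfolding enat_le_N_before_iff by (metis distinct_card List.finite_set)
  qed
  then show ?thesis
    by simp
qed

section \<open>The best effort policy\<close>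

lemma beu_fire_iff:
  "beu_fire p \<omega> n \<longleftrightarrow> enat (beu_cnt p \<omega> n) \<le> N_before (fst \<omega>) (real n * p)
     \<and> enat (beu_cnt p \<omega> n) \<le> N_before (snd \<omega>) (real n * p)"
  by (simp add: beu_fire_def Let_def)

lemma beu_cnt_Suc:
  "beu_cnt p \<omega> (Suc n) = (if beu_fire p \<omega> n then Suc (beu_cnt p \<omega> n) else beu_cnt p \<omega> n)"
  by (simp add: beu_fire_iff Let_def)

declare beu_cnt.simps(2) [simp del]

lemma beu_cnt_mono: "m \<le> n \<Longrightarrow> beu_cnt p \<omega> m \<le> beu_cnt p \<omega> n"
  by (rule lift_Suc_mono_le) (simp_all add: beu_cnt_Suc)

lemma beu_cnt_le: "beu_cnt p \<omega> n \<le> n"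
  by (induction n) (auto simp: beu_cnt_Suc)

lemma beu_cnt_less_of_fire: "beu_fire p \<omega> m \<Longrightarrow> m < n \<Longrightarrow> beu_cnt p \<omega> m < beu_cnt p \<omega> n"
  using beu_cnt_mono[of "Suc m" n p \<omega>] by (simp add: beu_cnt_Suc)

lemma beu_fire_inj:
  assumes "beu_fire p \<omega> m" "beu_fire p \<omega> n" "beu_cnt p \<omega> m = beu_cnt p \<omega> n"
  shows "m = n"
  using beu_cnt_less_of_fire[OF assms(1), of n] beu_cnt_less_of_fire[OF assms(2), of m] assms(3)
  by (metis less_irrefl linorder_neqE_nat)

lemma beu_fire_of_cnt_greater: "i < beu_cnt p \<omega> n \<Longrightarrow> \<exists>m<n. beu_fire p \<omega> m \<and> beu_cnt p \<omega> m = i"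
proof (induction n)
  case (Suc n)
  show ?case
  proof (cases "i < beu_cnt p \<omega> n")
    case False
    with Suc.prems have "beu_fire p \<omega> n" "beu_cnt p \<omega> n = i"
      by (auto simp: beu_cnt_Suc split: if_splits)
    then show ?thesis
      by blast
  qed (use Suc.IH less_SucI in blast)
qed simp

lemma beu_fire_0: "beu_fire p \<omega> 0"
  by (simp add: beu_fire_iff zero_enat_def[symmetric])

lemma snd_beu_policy: "snd (beu_policy d db \<omega>) i = fst (beu_policy d db \<omega>) i + ereal d"
  by (simp add: beu_policy_def Let_def)

lemma fst_beu_policy:
  assumes "beu_fire (max 1 (d + db)) \<omega> n"
  shows "fst (beu_policy d db \<omega>) (beu_cnt (max 1 (d + db)) \<omega> n) = ereal (real n * max 1 (d + db))"
proof -
  let ?p = "max 1 (d + db)"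
  have "(LEAST m. beu_fire ?p \<omega> m \<and> beu_cnt ?p \<omega> m = beu_cnt ?p \<omega> n) = n"
    using assms by (intro Least_equality) (auto dest: beu_fire_inj)
  then show ?thesis
    using assms by (auto simp: beu_policy_def Let_def)
qed

lemma fst_beu_policy_cases:
  obtains (fires) n where "beu_fire (max 1 (d + db)) \<omega> n" "beu_cnt (max 1 (d + db)) \<omega> n = i"
      "fst (beu_policy d db \<omega>) i = ereal (real n * max 1 (d + db))"
  | (never) "\<nexists>n. beu_fire (max 1 (d + db)) \<omega> n \<and> beu_cnt (max 1 (d + db)) \<omega> n = i"
      "fst (beu_policy d db \<omega>) i = \<infinity>"
proof (cases "\<exists>n. beu_fire (max 1 (d + db)) \<omega> n \<and> beu_cnt (max 1 (d + db)) \<omega> n = i")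
  case True
  then show ?thesis
    using fires fst_beu_policy by blast
next
  case False
  then show ?thesis
    by (intro never) (auto simp: beu_policy_def Let_def)
qed

text \<open>Successive transmissions are at least one slot apart, and a slot has length at least
  \<open>d + db\<close>. The relay's battery is checked at the start of the slot and can only have
  gained packets when it forwards, \<open>d\<close> later.\<close>

lemma feasible_sched_beu:
  assumes "0 < d" "0 < db"
  shows "feasible_sched d db \<omega> (beu_policy d db \<omega>)"
  unfolding feasible_sched_def
proof (intro conjI allI impI)
  let ?p = "max 1 (d + db)"
  let ?t = "fst (beu_policy d db \<omega>)"
  have p: "0 \<le> ?p"
    by simp
  show "0 \<le> ?t 0"
    by (rule fst_beu_policy_cases[of d db \<omega> 0]) auto
  fix i
  show "?t i + ereal d \<le> snd (beu_policy d db \<omega>) i"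
    by (simp add: snd_beu_policy)
  show "snd (beu_policy d db \<omega>) i + ereal db \<le> ?t (Suc i)"
  proof (cases rule: fst_beu_policy_cases[of d db \<omega> "Suc i"])
    case (fires m)
    then obtain n where n: "n < m" "beu_fire ?p \<omega> n" "beu_cnt ?p \<omega> n = i"
      using beu_fire_of_cnt_greater[of i ?p \<omega> m] by auto
    have "real n * ?p + d + db \<le> real n * ?p + ?p"
      by simp
    also have "\<dots> = real (Suc n) * ?p"
      by (simp add: algebra_simps)
    also have "\<dots> \<le> real m * ?p"
      using n p by (intro mult_right_mono) auto
    finally show ?thesis
      using fires fst_beu_policy[OF n(2)] n by (simp add: snd_beu_policy)
  qed simp
  show "enat i \<le> N_before (fst \<omega>) (real_of_ereal (?t i))" if "?t i \<noteq> \<infinity>"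
    using that by (cases rule: fst_beu_policy_cases[of d db \<omega> i]) (auto simp: beu_fire_iff)
  show "enat i \<le> N_before (snd \<omega>) (real_of_ereal (snd (beu_policy d db \<omega>) i))"
    if "snd (beu_policy d db \<omega>) i \<noteq> \<infinity>"
    using that assms by (cases rule: fst_beu_policy_cases[of d db \<omega> i])
      (auto simp: beu_fire_iff snd_beu_policy elim!: enat_le_N_before_mono)
qed

section \<open>Causality and measurability of the policy\<close>

text \<open>The decision in slot \<open>n\<close> reads only arrivals strictly before
  \<open>real n * p\<close>, and these are determined by the counts up to \<open>s\<close>.\<close>

lemma beu_cnt_cong:
  assumes "0 \<le> p" and "\<And>r. r \<le> s \<Longrightarrow> N_upto (fst \<omega>) r = N_upto (fst \<omega>') r \<and> N_upto (snd \<omega>) r = N_upto (snd \<omega>') r"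
    and "real n * p \<le> s"
  shows "beu_cnt p \<omega> n = beu_cnt p \<omega>' n" "beu_fire p \<omega> n = beu_fire p \<omega>' n"
proof -
  have *: "enat c \<le> N_before (fst \<omega>) x \<longleftrightarrow> enat c \<le> N_before (fst \<omega>') x"
    "enat c \<le> N_before (snd \<omega>) x \<longleftrightarrow> enat c \<le> N_before (snd \<omega>') x" if "x \<le> s" for c x
    unfolding enat_le_N_before_iff_N_upto using assms(2) that by (metis less_le_trans less_imp_le)+
  have "beu_cnt p \<omega> n = beu_cnt p \<omega>' n \<and> beu_fire p \<omega> n = beu_fire p \<omega>' n"
    using assms(3)
  proof (induction n)
    case (Suc n)
    have "real n * p \<le> real (Suc n) * p"
      using assms(1) by (intro mult_right_mono) auto
    then have "beu_cnt p \<omega> (Suc n) = beu_cnt p \<omega>' (Suc n)"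
      using Suc by (simp add: beu_cnt_Suc)
    then show ?case
      using Suc.prems by (auto simp: beu_fire_iff *)
  qed (simp add: beu_fire_0)
  then show "beu_cnt p \<omega> n = beu_cnt p \<omega>' n" "beu_fire p \<omega> n = beu_fire p \<omega>' n"
    by auto
qed

lemma fst_beu_policy_cong:
  assumes "\<And>r. r \<le> s \<Longrightarrow> N_upto (fst \<omega>) r = N_upto (fst \<omega>') r \<and> N_upto (snd \<omega>) r = N_upto (snd \<omega>') r"
    and "fst (beu_policy d db \<omega>) i \<le> ereal s"
  shows "fst (beu_policy d db \<omega>') i = fst (beu_policy d db \<omega>) i"
proof (cases rule: fst_beu_policy_cases[of d db \<omega> i])
  case (fires n)
  then have "real n * max 1 (d + db) \<le> s"
    using assms(2) by simp
  from beu_cnt_cong[OF _ assms(1) this] fires show ?thesis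
    using fst_beu_policy[of d db \<omega>' n] by simp
qed (use assms in simp)

lemma online_beu:
  assumes "0 < d"
  shows "online (beu_policy d db)"
proof -
  let ?t = "\<lambda>\<omega>. fst (beu_policy d db \<omega>)"
  have "(?t \<omega> i \<le> ereal s \<longleftrightarrow> ?t \<omega>' i \<le> ereal s) \<and> (?t \<omega> i \<le> ereal s \<longrightarrow> ?t \<omega> i = ?t \<omega>' i)
     \<and> (?t \<omega> i + ereal d \<le> ereal s \<longleftrightarrow> ?t \<omega>' i + ereal d \<le> ereal s)
     \<and> (?t \<omega> i + ereal d \<le> ereal s \<longrightarrow> ?t \<omega> i + ereal d = ?t \<omega>' i + ereal d)"
    if agree: "\<And>r. r \<le> s \<Longrightarrow> N_upto (fst \<omega>) r = N_upto (fst \<omega>') r \<and> N_upto (snd \<omega>) r = N_upto (snd \<omega>') r"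
    for s \<omega> \<omega>' i
  proof -
    have "?t \<omega>' i = ?t \<omega> i" if "?t \<omega> i \<le> ereal s"
      using fst_beu_policy_cong[OF agree that] .
    moreover have "?t \<omega> i = ?t \<omega>' i" if "?t \<omega>' i \<le> ereal s"
      using fst_beu_policy_cong[OF _ that, of \<omega>] agree by simp
    \<comment> \<open>A forwarding time observed by \<open>s\<close> comes from a transmission
      observed by \<open>s\<close>, which reduces the relay to the source.\<close>
    moreover have "x \<le> ereal s" if "x + ereal d \<le> ereal s" for x
      using that assms by (cases x) auto
    ultimately show ?thesis
      by metis
  qed
  then show ?thesis
    unfolding online_def snd_beu_policy by blast
qed

lemma measurable_beu_cnt [measurable]: "(\<lambda>\<omega>. beu_cnt p \<omega> n) \<in> Omega \<rightarrow>\<^sub>M count_space UNIV"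
  and pred_beu_fire [measurable]: "Measurable.pred Omega (\<lambda>\<omega>. beu_fire p \<omega> n)"
proof -
  have [measurable]: "Measurable.pred Omega (\<lambda>\<omega>. enat c \<le> N_before (fst \<omega>) x)"
    "Measurable.pred Omega (\<lambda>\<omega>. enat c \<le> N_before (snd \<omega>) x)" for c x
    by (rule pred_enat_le_N_before[OF measurable_fst_Omega] pred_enat_le_N_before[OF measurable_snd_Omega])+
  have fire: "Measurable.pred Omega (\<lambda>\<omega>. beu_fire p \<omega> n)"
    if [measurable]: "(\<lambda>\<omega>. beu_cnt p \<omega> n) \<in> Omega \<rightarrow>\<^sub>M count_space UNIV" for n
  proof -
    \<comment> \<open>Splitting over the countably many values of the random count leaves events
      with a fixed threshold \<open>c\<close>.\<close>
    have "Measurable.pred Omega (\<lambda>\<omega>. \<exists>c. beu_cnt p \<omega> n = c \<and>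
        enat c \<le> N_before (fst \<omega>) (real n * p) \<and> enat c \<le> N_before (snd \<omega>) (real n * p))"
      by measurable
    then show ?thesis
      by (simp add: beu_fire_iff)
  qed
  show cnt: "(\<lambda>\<omega>. beu_cnt p \<omega> n) \<in> Omega \<rightarrow>\<^sub>M count_space UNIV" for n
  proof (induction n)
    case (Suc n)
    note [measurable] = Suc fire[OF Suc]
    show ?case
      unfolding beu_cnt_Suc by measurable
  qed simp
  show "Measurable.pred Omega (\<lambda>\<omega>. beu_fire p \<omega> n)"
    by (rule fire[OF cnt])
qed

lemma measurable_fst_beu_policy [measurable]: "(\<lambda>\<omega>. fst (beu_policy d db \<omega>) i) \<in> borel_measurable Omega"
  unfolding beu_policy_def Let_def fst_conv by measurable

lemma feasible_beu: "0 < d \<Longrightarrow> 0 < db \<Longrightarrow> feasible d db (beu_policy d db)"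
  unfolding feasible_def by (simp add: feasible_sched_beu online_beu snd_beu_policy)

section \<open>Slots since the last transmission\<close>

text \<open>The last firing slot up to \<open>n\<close> is \<open>n - beu_gap p \<omega> n\<close>.
  The initial value 0 is correct because the initial packets make slot 0 fire.\<close>

primrec beu_gap :: "real \<Rightarrow> path \<Rightarrow> nat \<Rightarrow> nat" where
  "beu_gap p \<omega> 0 = 0"
| "beu_gap p \<omega> (Suc n) = (if beu_fire p \<omega> (Suc n) then 0 else Suc (beu_gap p \<omega> n))"

lemma beu_gap_le: "beu_gap p \<omega> n \<le> n"
  by (induction n) auto

lemma beu_gap_eq_0: "beu_fire p \<omega> n \<Longrightarrow> beu_gap p \<omega> n = 0"
  by (cases n) auto

lemma not_beu_fire_gap: "0 < beu_gap p \<omega> n \<Longrightarrow> \<not> beu_fire p \<omega> n"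
  by (cases n) (auto split: if_splits)

lemma beu_fire_last: "beu_fire p \<omega> (n - beu_gap p \<omega> n)"
  by (induction n) (auto simp: beu_fire_0)

lemma beu_cnt_last: "Suc (beu_cnt p \<omega> (n - beu_gap p \<omega> n)) = beu_cnt p \<omega> (Suc n)"
  by (induction n) (auto simp: beu_cnt_Suc[of p \<omega> "Suc _"] beu_cnt_Suc[of p \<omega> 0] beu_fire_0)

lemma measurable_beu_gap [measurable]: "(\<lambda>\<omega>. beu_gap p \<omega> n) \<in> Omega \<rightarrow>\<^sub>M count_space UNIV"
proof (induction n)
  case (Suc n)
  note [measurable] = this
  show ?case
    by simp
qed simp

text \<open>The \<open>c\<close> arrivals before \<open>a\<close> are the only ones before
  \<open>b\<close>, since one more would raise the count to \<open>c + 1\<close>. The least index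
  outside this set serves as the index \<open>m\<close> of \<open>idle\<close>.\<close>

lemma idleI:
  assumes "enat c \<le> N_before X a" "\<not> enat (Suc c) \<le> N_before X b" "a \<le> a'" "a \<le> b"
  shows "X \<in> idle a' b"
proof -
  obtain F where F: "finite F" "card F = c" "\<And>k. k \<in> F \<Longrightarrow> arr_time X k < a"
    using assms(1) by (auto simp: enat_le_N_before_iff)
  have late: "b \<le> arr_time X k" if "k \<notin> F" for k
  proof (rule ccontr)
    assume "\<not> b \<le> arr_time X k"
    then have "\<forall>j\<in>insert k F. arr_time X j < b"
      using F(3) assms(4) by force
    moreover have "card (insert k F) = Suc c" "finite (insert k F)"
      using F that by auto
    ultimately show False
      using assms(2) unfolding enat_le_N_before_iff by blast
  qed
  define m where "m = (LEAST k. k \<notin> F)"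
  have "m \<notin> F"
    unfolding m_def using F(1) by (rule LeastI_ex[OF ex_new_if_finite[OF infinite_UNIV_nat]])
  moreover have "arr_time X l < a'" if "l < m" for l
    using not_less_Least[of l "\<lambda>k. k \<notin> F"] that F(3)[of l] assms(3) by (auto simp: m_def)
  ultimately show ?thesis
    using late by (auto simp: idle_def)
qed

text \<open>At the last firing slot both nodes had harvested as many packets as had been spent
  before it. If slot \<open>n\<close> is silent, one node has still not harvested one more, so it
  received nothing since that firing slot and in particular during the last \<open>r\<close>
  slots.\<close>

lemma idle_of_beu_gap:
  assumes "0 \<le> p" "0 < r" "r \<le> beu_gap p \<omega> n"
  shows "fst \<omega> \<in> idle (real (n - r) * p) (real n * p) \<or> snd \<omega> \<in> idle (real (n - r) * p) (real n * p)"
proof -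
  let ?j = "n - beu_gap p \<omega> n"
  have "\<not> beu_fire p \<omega> n"
    using assms not_beu_fire_gap by auto
  then have "beu_cnt p \<omega> n = Suc (beu_cnt p \<omega> ?j)"
    by (simp add: beu_cnt_last beu_cnt_Suc)
  with \<open>\<not> beu_fire p \<omega> n\<close> have "\<not> enat (Suc (beu_cnt p \<omega> ?j)) \<le> N_before (fst \<omega>) (real n * p) \<or>
      \<not> enat (Suc (beu_cnt p \<omega> ?j)) \<le> N_before (snd \<omega>) (real n * p)"
    by (simp add: beu_fire_iff)
  moreover have "enat (beu_cnt p \<omega> ?j) \<le> N_before (fst \<omega>) (real ?j * p)"
    "enat (beu_cnt p \<omega> ?j) \<le> N_before (snd \<omega>) (real ?j * p)"
    using beu_fire_last[of p \<omega> n] by (auto simp: beu_fire_iff)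
  moreover have "real ?j * p \<le> real (n - r) * p" "real ?j * p \<le> real n * p"
    using assms by (auto intro!: mult_right_mono)
  ultimately show ?thesis
    using idleI by blast
qed

section \<open>The number of silent slots\<close>

definition deviating :: "nat \<Rightarrow> real \<Rightarrow> (nat \<Rightarrow> real) set" where
  "deviating n \<delta> = (\<Union>l<n. {\<omega>. \<delta> \<le> \<bar>arr_time \<omega> l - real (Suc l)\<bar>})"

lemma deviating_sets [measurable]: "deviating n \<delta> \<in> sets gaps"
proof -
  have "{\<omega>\<in>space gaps. \<delta> \<le> \<bar>arr_time \<omega> l - real (Suc l)\<bar>} \<in> sets gaps" for l
    by measurable
  then show ?thesis
    unfolding deviating_def by auto
qed

lemma emeasure_deviating:
  assumes "0 < \<delta>"
  shows "emeasure gaps (deviating n \<delta>) \<le> ennreal (9 * real n ^ 3 / \<delta> ^ 4)"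
proof -
  have "{\<omega>\<in>space gaps. \<delta> \<le> \<bar>arr_time \<omega> l - real (Suc l)\<bar>} \<in> sets gaps" for l
    by measurable
  then have "emeasure gaps (deviating n \<delta>) \<le> (\<Sum>l<n. emeasure gaps {\<omega>. \<delta> \<le> \<bar>arr_time \<omega> l - real (Suc l)\<bar>})"
    unfolding deviating_def by (intro emeasure_subadditive_finite) auto
  also have "\<dots> \<le> (\<Sum>l<n. ennreal (9 * real n ^ 2 / \<delta> ^ 4))"
  proof (intro sum_mono)
    fix l assume "l \<in> {..<n}"
    then have "real (Suc l) ^ 2 \<le> real n ^ 2"
      by (intro power_mono) auto
    then show "emeasure gaps {\<omega>. \<delta> \<le> \<bar>arr_time \<omega> l - real (Suc l)\<bar>} \<le> ennreal (9 * real n ^ 2 / \<delta> ^ 4)"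
      using assms by (intro order_trans[OF arr_time_deviation[OF assms]] ennreal_leI divide_right_mono) auto
  qed
  also have "\<dots> = ennreal (\<Sum>l<n. 9 * real n ^ 2 / \<delta> ^ 4)"
    by (rule sum_ennreal) auto
  also have "\<dots> = ennreal (9 * real n ^ 3 / \<delta> ^ 4)"
    by (simp add: power2_eq_square power3_eq_cube)
  finally show ?thesis .
qed

lemma early_arrival_of_failure:
  assumes "\<not> enat c \<le> N_before X s"
  shows "\<exists>l<c. s \<le> arr_time X l"
proof (rule ccontr)
  assume "\<not> (\<exists>l<c. s \<le> arr_time X l)"
  then have "finite {..<c} \<and> card {..<c} = c \<and> (\<forall>k\<in>{..<c}. arr_time X k < s)"
    by (auto simp: not_le)
  then show False
    using assms unfolding enat_le_N_before_iff by blast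
qed

text \<open>A firing slot raises both sides by 1. A silent slot \<open>k\<close> means that some
  arrival \<open>l < beu_cnt p \<omega> k\<close> has not come by time \<open>real k * p\<close>;
  without large deviations it comes before \<open>\<delta> + real (Suc l)\<close>, hence
  \<open>real k\<close> is below \<open>\<delta>\<close> plus the count. The extra 1 pays for
  passing from \<open>k\<close> to \<open>Suc k\<close>.\<close>

lemma beu_cnt_ge:
  assumes "1 \<le> p" "0 \<le> \<delta>" "fst \<omega> \<notin> deviating n \<delta>" "snd \<omega> \<notin> deviating n \<delta>" "k \<le> n"
  shows "real k - (\<delta> + 1) \<le> real (beu_cnt p \<omega> k)"
  using assms(5)
proof (induction k)
  case (Suc k)
  show ?case
  proof (cases "beu_fire p \<omega> k")
    case False
    then obtain X where X: "X = fst \<omega> \<or> X = snd \<omega>" "\<not> enat (beu_cnt p \<omega> k) \<le> N_before X (real k * p)"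
      unfolding beu_fire_iff by blast
    obtain l where l: "l < beu_cnt p \<omega> k" "real k * p \<le> arr_time X l"
      using early_arrival_of_failure[OF X(2)] by blast
    have "l < n"
      using l(1) beu_cnt_le[of p \<omega> k] Suc.prems by simp
    then have "\<not> \<delta> \<le> \<bar>arr_time X l - real (Suc l)\<bar>"
      using X(1) assms(3,4) unfolding deviating_def by blast
    then have "arr_time X l < \<delta> + real (Suc l)"
      by linarith
    moreover have "real k * 1 \<le> real k * p"
      using assms(1) by (intro mult_left_mono) auto
    moreover have "real (Suc l) \<le> real (beu_cnt p \<omega> k)"
      using l(1) by linarith
    ultimately show ?thesis
      using l(2) False by (simp add: beu_cnt_Suc)
  qed (use Suc in \<open>simp add: beu_cnt_Suc\<close>)
qed (use assms in simp)

lemma sum_not_beu_fire: "(\<Sum>k<n. of_bool (\<not> beu_fire p \<omega> k)) = real n - real (beu_cnt p \<omega> n)"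
  by (induction n) (auto simp: beu_cnt_Suc)

section \<open>The expected total gap\<close>

text \<open>Layer-cake form. The first \<open>M\<close> units are charged to slot \<open>k\<close>
  being silent; every level \<open>r\<close> above \<open>M\<close> that the gap reaches is charged
  to an idle period of \<open>r\<close> slots at one of the nodes.\<close>

lemma beu_gap_le_truncated:
  assumes "0 \<le> p"
  shows "real (beu_gap p \<omega> k) \<le> real M * of_bool (\<not> beu_fire p \<omega> k) +
    (\<Sum>r\<in>{M<..k}. indicator (idle (real (k - r) * p) (real k * p)) (fst \<omega>) +
                   indicator (idle (real (k - r) * p) (real k * p)) (snd \<omega>))"
    (is "_ \<le> _ + (\<Sum>r\<in>_. ?I r)")
proof (cases "beu_gap p \<omega> k \<le> M")
  case True
  then show ?thesis
    by (cases "beu_fire p \<omega> k") (auto simp: beu_gap_eq_0 intro!: add_increasing2 sum_nonneg)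
next
  case False
  have "real (beu_gap p \<omega> k) = real M + (\<Sum>r\<in>{M<..beu_gap p \<omega> k}. 1)"
    using False by simp
  also have "(\<Sum>r\<in>{M<..beu_gap p \<omega> k}. 1) \<le> (\<Sum>r\<in>{M<..beu_gap p \<omega> k}. ?I r)"
  proof (intro sum_mono)
    fix r assume "r \<in> {M<..beu_gap p \<omega> k}"
    then show "1 \<le> ?I r"
      using idle_of_beu_gap[OF assms, of r \<omega> k] by (auto simp: indicator_def)
  qed
  also have "\<dots> \<le> (\<Sum>r\<in>{M<..k}. ?I r)"
    using beu_gap_le[of p \<omega> k] by (intro sum_mono2) auto
  finally show ?thesis
    using False not_beu_fire_gap[of p \<omega> k] by simp
qed

lemma sum_half_powers_le: "(\<Sum>r\<in>{M<..k}. (1 / 2) ^ r) \<le> (1 / 2 :: real) ^ M"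
proof (cases "M \<le> k")
  case True
  have "(\<Sum>r\<in>{M<..k}. (1 / 2) ^ r) = (1 / 2 :: real) ^ M - (1 / 2) ^ k"
    using True
  proof (induction k rule: dec_induct)
    case (step k)
    have "{M<..Suc k} = insert (Suc k) {M<..k}"
      using step by auto
    then show ?case
      using step by simp
  qed simp
  then show ?thesis
    by simp
qed simp

lemma emeasure_idle_slots:
  assumes "1 \<le> p" "r \<le> k"
  shows "emeasure gaps (idle (real (k - r) * p) (real k * p)) \<le> ennreal ((1 / 2) ^ r)"
proof -
  have "real r * 1 \<le> real r * p"
    using assms by (intro mult_left_mono) auto
  \<comment> \<open>Replacing exp (- 1) by 1/2 gives a geometric tail with a closed-form
    sum.\<close>
  have "2 \<le> exp (1 :: real)"
    using exp_ge_add_one_self[of "1 :: real"] by simp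
  then have "exp (- 1) \<le> (1 / 2 :: real)"
    by (simp add: exp_minus field_simps)
  have "emeasure gaps (idle (real (k - r) * p) (real k * p)) \<le> ennreal (exp (- (real k * p - real (k - r) * p)))"
    using assms by (intro emeasure_idle mult_right_mono) auto
  also have "\<dots> \<le> ennreal (exp (real r * (- 1)))"
    using assms \<open>real r * 1 \<le> real r * p\<close> by (intro ennreal_leI) (simp add: of_nat_diff algebra_simps)
  also have "exp (real r * (- 1)) = exp (- 1 :: real) ^ r"
    by (rule exp_of_nat_mult)
  also have "ennreal (exp (- 1) ^ r) \<le> ennreal ((1 / 2) ^ r)"
    using \<open>exp (- 1) \<le> (1 / 2 :: real)\<close> by (intro ennreal_leI power_mono) auto
  finally show ?thesis .
qed

text \<open>Without large deviations at most \<open>\<delta> + 1\<close> of the first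
  \<open>n\<close> slots are silent; otherwise the trivial bound \<open>n\<close> is used, weighted
  by the indicators of the bad events.\<close>

lemma sum_beu_gap_le:
  assumes "1 \<le> p" "0 < \<delta>"
  shows "(\<Sum>k<n. real (beu_gap p \<omega> k)) \<le>
    real M * (\<delta> + 1) + real M * real n * (indicator (deviating n \<delta>) (fst \<omega>) + indicator (deviating n \<delta>) (snd \<omega>)) +
    (\<Sum>k<n. \<Sum>r\<in>{M<..k}. indicator (idle (real (k - r) * p) (real k * p)) (fst \<omega>) +
                   indicator (idle (real (k - r) * p) (real k * p)) (snd \<omega>))"
proof -
  have "(\<Sum>k<n. real (beu_gap p \<omega> k)) \<le> real M * (real n - real (beu_cnt p \<omega> n)) +
    (\<Sum>k<n. \<Sum>r\<in>{M<..k}. indicator (idle (real (k - r) * p) (real k * p)) (fst \<omega>) +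
                   indicator (idle (real (k - r) * p) (real k * p)) (snd \<omega>))"
    unfolding sum_not_beu_fire[symmetric] sum_distrib_left sum.distrib[symmetric]
    using assms beu_gap_le_truncated[of p \<omega> _ M] by (intro sum_mono) (simp add: sum.distrib)
  moreover have "real n - real (beu_cnt p \<omega> n) \<le> (\<delta> + 1) +
      real n * (indicator (deviating n \<delta>) (fst \<omega>) + indicator (deviating n \<delta>) (snd \<omega>))"
    using beu_cnt_ge[of p \<delta> \<omega> n n] assms by (auto simp: indicator_def)
  then have "real M * (real n - real (beu_cnt p \<omega> n)) \<le> real M * ((\<delta> + 1) +
      real n * (indicator (deviating n \<delta>) (fst \<omega>) + indicator (deviating n \<delta>) (snd \<omega>)))"
    by (rule mult_left_mono) simp
  ultimately show ?thesis
    by (simp add: algebra_simps)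
qed

text \<open>Expectation of the pathwise bound. Both nodes have the same law, whence 18 = 2 * 9 and
  the factor 2 in front of the geometric tail.\<close>

lemma nn_integral_sum_beu_gap_le:
  assumes "1 \<le> p" "0 < \<delta>"
  shows "(\<integral>\<^sup>+\<omega>. ennreal (\<Sum>k<n. real (beu_gap p \<omega> k)) \<partial>Omega) \<le>
    ennreal (real M * (\<delta> + 1) + 18 * real M * real n ^ 4 / \<delta> ^ 4 + 2 * real n * (1 / 2) ^ M)"
proof -
  let ?B = "\<lambda>X. indicator (deviating n \<delta>) X :: ennreal"
  let ?J = "\<lambda>k r X. indicator (idle (real (k - r) * p) (real k * p)) X :: ennreal"
  have "(\<integral>\<^sup>+\<omega>. ennreal (\<Sum>k<n. real (beu_gap p \<omega> k)) \<partial>Omega) \<le>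
     (\<integral>\<^sup>+\<omega>. ennreal (real M * (\<delta> + 1)) + ennreal (real M * real n) * (?B (fst \<omega>) + ?B (snd \<omega>)) +
       (\<Sum>k<n. \<Sum>r\<in>{M<..k}. ?J k r (fst \<omega>) + ?J k r (snd \<omega>)) \<partial>Omega)"
  proof (intro nn_integral_mono)
    fix \<omega>
    have ind: "indicator A x = ennreal (indicator A x)" for A :: "(nat \<Rightarrow> real) set" and x
      by (simp split: split_indicator)
    have "ennreal (real M * (\<delta> + 1)) + ennreal (real M * real n) * (?B (fst \<omega>) + ?B (snd \<omega>)) +
       (\<Sum>k<n. \<Sum>r\<in>{M<..k}. ?J k r (fst \<omega>) + ?J k r (snd \<omega>)) =
      ennreal (real M * (\<delta> + 1) + real M * real n * (indicator (deviating n \<delta>) (fst \<omega>) + indicator (deviating n \<delta>) (snd \<omega>)) +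
    (\<Sum>k<n. \<Sum>r\<in>{M<..k}. indicator (idle (real (k - r) * p) (real k * p)) (fst \<omega>) +
                   indicator (idle (real (k - r) * p) (real k * p)) (snd \<omega>)))"
      using assms unfolding ind
      by (simp add: ennreal_plus[symmetric] ennreal_mult[symmetric] sum_nonneg del: ennreal_plus)
    then show "ennreal (\<Sum>k<n. real (beu_gap p \<omega> k)) \<le>
      ennreal (real M * (\<delta> + 1)) + ennreal (real M * real n) * (?B (fst \<omega>) + ?B (snd \<omega>)) +
       (\<Sum>k<n. \<Sum>r\<in>{M<..k}. ?J k r (fst \<omega>) + ?J k r (snd \<omega>))"
      using sum_beu_gap_le[OF assms, of \<omega> n M] by (simp add: ennreal_leI)
  qed
  also have "\<dots> = ennreal (real M * (\<delta> + 1)) + ennreal (real M * real n) *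
      (emeasure gaps (deviating n \<delta>) + emeasure gaps (deviating n \<delta>)) +
       (\<Sum>k<n. \<Sum>r\<in>{M<..k}. emeasure gaps (idle (real (k - r) * p) (real k * p)) +
          emeasure gaps (idle (real (k - r) * p) (real k * p)))"
    by (simp add: nn_integral_add nn_integral_cmult nn_integral_sum nn_integral_Omega_fst nn_integral_Omega_snd
       Omega.emeasure_space_1[simplified])
  also have "\<dots> \<le> ennreal (real M * (\<delta> + 1)) + ennreal (real M * real n) *
      (ennreal (9 * real n ^ 3 / \<delta> ^ 4) + ennreal (9 * real n ^ 3 / \<delta> ^ 4)) +
       (\<Sum>k<n. \<Sum>r\<in>{M<..k}. ennreal ((1 / 2) ^ r) + ennreal ((1 / 2) ^ r))"
    using assms by (intro add_mono sum_mono mult_left_mono emeasure_deviating emeasure_idle_slots) auto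
  also have "\<dots> = ennreal (real M * (\<delta> + 1) + real M * real n * (2 * (9 * real n ^ 3 / \<delta> ^ 4)) +
       2 * (\<Sum>k<n. \<Sum>r\<in>{M<..k}. (1 / 2) ^ r))"
    using assms by (simp add: ennreal_plus[symmetric] ennreal_mult[symmetric] sum_nonneg sum_distrib_left del: ennreal_plus)
  also have "\<dots> \<le> ennreal (real M * (\<delta> + 1) + 18 * real M * real n ^ 4 / \<delta> ^ 4 + 2 * real n * (1 / 2) ^ M)"
  proof (intro ennreal_leI)
    have "(\<Sum>k<n. \<Sum>r\<in>{M<..k}. (1 / 2 :: real) ^ r) \<le> (\<Sum>k<n. (1 / 2) ^ M)"
      by (intro sum_mono sum_half_powers_le)
    then show "real M * (\<delta> + 1) + real M * real n * (2 * (9 * real n ^ 3 / \<delta> ^ 4)) +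
       2 * (\<Sum>k<n. \<Sum>r\<in>{M<..k}. (1 / 2) ^ r) \<le>
       real M * (\<delta> + 1) + 18 * real M * real n ^ 4 / \<delta> ^ 4 + 2 * real n * (1 / 2) ^ M"
      by (simp add: eval_nat_numeral algebra_simps)
  qed
  finally show ?thesis .
qed

lemma eventually_sum_beu_gap_le:
  assumes "1 \<le> p" "0 < \<eta>"
  shows "\<forall>\<^sub>F n in sequentially. (\<integral>\<^sup>+\<omega>. ennreal (\<Sum>k<n. real (beu_gap p \<omega> k)) \<partial>Omega) \<le> ennreal (\<eta> * real n)"
proof -
  obtain M where M: "(1 / 2 :: real) ^ M < \<eta> / 4"
    using real_arch_pow_inv[of "\<eta> / 4" "1 / 2"] assms by auto
  \<comment> \<open>First \<open>M\<close> makes the idle tail small, then \<open>\<epsilon>\<close>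
    is small relative to \<open>M\<close>. With \<open>\<delta> = \<epsilon> * real n\<close> the
    silent slots cost less than half of \<open>\<eta> * real n\<close>, up to terms that stay
    bounded in \<open>n\<close>.\<close>
  define \<epsilon> where "\<epsilon> = \<eta> / (4 * (real M + 1))"
  have "0 < \<epsilon>"
    using assms by (simp add: \<epsilon>_def)
  have "(\<lambda>n. real M * (\<epsilon> + 1 / real n) + 18 * real M / \<epsilon> ^ 4 * (1 / real n)) \<longlonglongrightarrow>
      real M * (\<epsilon> + 0) + 18 * real M / \<epsilon> ^ 4 * 0"
    by (intro tendsto_intros lim_1_over_n)
  moreover have "real M * \<epsilon> < \<eta> / 2"
    using assms by (simp add: \<epsilon>_def field_simps add_pos_nonneg)
  ultimately have "\<forall>\<^sub>F n in sequentially. real M * (\<epsilon> + 1 / real n) + 18 * real M / \<epsilon> ^ 4 * (1 / real n) < \<eta> / 2"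
    by (intro order_tendstoD(2)) auto
  with eventually_gt_at_top[of 0] show ?thesis
  proof eventually_elim
    case (elim n)
    have "real M * (\<epsilon> * real n + 1) + 18 * real M * real n ^ 4 / (\<epsilon> * real n) ^ 4 + 2 * real n * (1 / 2) ^ M
       = real n * (real M * (\<epsilon> + 1 / real n) + 18 * real M / \<epsilon> ^ 4 * (1 / real n) + 2 * (1 / 2) ^ M)"
      using elim(1) \<open>0 < \<epsilon>\<close> by (simp add: field_simps)
    also have "\<dots> \<le> real n * \<eta>"
      using elim(2) M by (intro mult_left_mono of_nat_0_le_iff) linarith
    finally have "real M * (\<epsilon> * real n + 1) + 18 * real M * real n ^ 4 / (\<epsilon> * real n) ^ 4 + 2 * real n * (1 / 2) ^ M
        \<le> \<eta> * real n"
      by (simp only: mult.commute)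
    moreover have "0 < \<epsilon> * real n"
      using elim(1) \<open>0 < \<epsilon>\<close> by simp
    ultimately show ?case
      by (intro order_trans[OF nn_integral_sum_beu_gap_le[OF assms(1)] ennreal_leI])
  qed
qed

section \<open>Age of the best effort policy\<close>

lemma feasible_sched_nonneg:
  assumes "feasible_sched d db \<omega> S" "0 < d" "0 < db"
  shows "0 \<le> fst S i"
proof (induction i)
  case (Suc i)
  have "fst S i + ereal d \<le> snd S i" "snd S i + ereal db \<le> fst S (Suc i)"
    using assms(1) by (auto simp: feasible_sched_def)
  moreover have "0 \<le> fst S i + ereal d"
    using Suc assms(2) by (simp add: add_nonneg_nonneg)
  ultimately have "0 \<le> snd S i"
    by (rule_tac order_trans)
  then have "0 \<le> snd S i + ereal db"
    using assms(3) by (simp add: add_nonneg_nonneg)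
  then show ?case
    using \<open>snd S i + ereal db \<le> fst S (Suc i)\<close> by (rule order_trans)
qed (use assms in \<open>simp add: feasible_sched_def\<close>)

lemma received_imp_sent:
  assumes "feasible_sched d db \<omega> S" "0 < d" "0 < db" "snd S i + ereal db < ereal s"
  obtains t where "fst S i = ereal t" "0 \<le> t" "t + (d + db) < s"
proof -
  have "fst S i + ereal d \<le> snd S i"
    using assms(1) by (auto simp: feasible_sched_def)
  then show thesis
    using feasible_sched_nonneg[OF assms(1-3), of i] assms(4) that
    by (cases "fst S i"; cases "snd S i") auto
qed

text \<open>Boundedness gives the real supremum in \<open>upd_gen\<close> its intended meaning: a
  received update was generated before \<open>s\<close>.\<close>

lemma bdd_above_upd_gen:
  assumes "feasible_sched d db \<omega> S" "0 < d" "0 < db"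
  shows "bdd_above ({0} \<union> {real_of_ereal (fst S i) |i. snd S i + ereal db < ereal s})"
proof (rule bdd_aboveI[where M="max 0 s"])
  fix x assume "x \<in> {0} \<union> {real_of_ereal (fst S i) |i. snd S i + ereal db < ereal s}"
  then show "x \<le> max 0 s"
    using assms(2,3) by (auto elim!: received_imp_sent[OF assms])
qed

lemma upd_gen_nonneg:
  assumes "feasible_sched d db \<omega> S" "0 < d" "0 < db"
  shows "0 \<le> upd_gen db S s"
  unfolding upd_gen_def by (intro cSup_upper bdd_above_upd_gen[OF assms]) auto

lemma upd_gen_ge:
  assumes "feasible_sched d db \<omega> S" "0 < d" "0 < db" "snd S i + ereal db < ereal s"
  shows "real_of_ereal (fst S i) \<le> upd_gen db S s"
  unfolding upd_gen_def using assms(4) by (intro cSup_upper bdd_above_upd_gen[OF assms(1-3)]) auto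

text \<open>The last firing slot up to \<open>k\<close> starts at \<open>real k * p\<close> minus
  \<open>p\<close> times the gap, where \<open>p = max 1 (d + db)\<close>, and its update has been
  received before \<open>s\<close>.\<close>

lemma age_beu_le:
  assumes "0 < d" "0 < db" "d + db + real k * max 1 (d + db) < s"
  shows "age db (beu_policy d db \<omega>) s \<le>
    s - real k * max 1 (d + db) + max 1 (d + db) * real (beu_gap (max 1 (d + db)) \<omega> k)"
proof -
  let ?p = "max 1 (d + db)"
  let ?j = "k - beu_gap ?p \<omega> k"
  have t: "fst (beu_policy d db \<omega>) (beu_cnt ?p \<omega> ?j) = ereal (real ?j * ?p)"
    by (rule fst_beu_policy[OF beu_fire_last])
  have j: "real ?j * ?p = real k * ?p - ?p * real (beu_gap ?p \<omega> k)"
    using beu_gap_le[of ?p \<omega> k] by (simp add: of_nat_diff algebra_simps)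
  moreover have "0 \<le> ?p * real (beu_gap ?p \<omega> k)"
    by simp
  ultimately have "real ?j * ?p + d + db < s"
    using assms(3) by linarith
  then have "real ?j * ?p \<le> upd_gen db (beu_policy d db \<omega>) s"
    using upd_gen_ge[OF feasible_sched_beu[OF assms(1,2)] assms(1,2), of \<omega> "beu_cnt ?p \<omega> ?j" s] t
    by (simp add: snd_beu_policy)
  then show ?thesis
    using j by (simp add: age_def)
qed

lemma nn_integral_ramp:
  assumes "0 \<le> a + c" "a \<le> b"
  shows "(\<integral>\<^sup>+s. ennreal (s + c) * indicator {a..b} s \<partial>lborel) = ennreal (((b + c)\<^sup>2 - (a + c)\<^sup>2) / 2)"
proof -
  have "(\<integral>\<^sup>+s. ennreal (s + c) * indicator {a..b} s \<partial>lborel) = ennreal ((b + c)\<^sup>2 / 2 - (a + c)\<^sup>2 / 2)"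
    using assms by (intro nn_integral_FTC_Icc) (auto intro!: derivative_eq_intros)
  then show ?thesis
    by (simp add: diff_divide_distrib)
qed

lemma slot_cover:
  fixes p a s :: real
  assumes "a < s" "s \<le> a + real n * p"
  shows "\<exists>k<n. a + real k * p < s \<and> s \<le> a + real (Suc k) * p"
  using assms(2)
proof (induction n)
  case (Suc n)
  show ?case
  proof (cases "s \<le> a + real n * p")
    case True
    then show ?thesis
      using Suc.IH less_SucI by blast
  next
    case False
    then show ?thesis
      using Suc.prems by (intro exI[of _ n]) simp
  qed
qed (use assms in simp)

text \<open>Up to time \<open>D\<close> the age is at most the time itself. Afterwards the slots are
  shifted by \<open>D\<close>, the total service delay, and on each of them the age is bounded by a
  line of slope 1.\<close>

lemma area_beu_le:
  fixes d db :: real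
  defines "D \<equiv> d + db"
  defines "p \<equiv> max 1 D"
  assumes "0 < d" "0 < db" "T \<le> D + real n * p"
  shows "area db (beu_policy d db \<omega>) T \<le>
    ennreal (D\<^sup>2 / 2 + real n * (p * D + p\<^sup>2 / 2)) + ennreal (p\<^sup>2) * ennreal (\<Sum>k<n. real (beu_gap p \<omega> k))"
proof -
  have D: "0 < D" and p: "1 \<le> p"
    using assms by auto
  let ?c = "\<lambda>k. p * real (beu_gap p \<omega> k) - real k * p"
  let ?I = "\<lambda>k. {D + real k * p..D + real (Suc k) * p}"
  have le: "real k * p \<le> real (Suc k) * p" for k
    using p by (intro mult_right_mono) auto
  have age0: "age db (beu_policy d db \<omega>) s \<le> s" for s
    using upd_gen_nonneg[OF feasible_sched_beu[OF assms(3,4)] assms(3,4), of \<omega> s] by (simp add: age_def)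
  have "area db (beu_policy d db \<omega>) T \<le>
    (\<integral>\<^sup>+s. ennreal (s + 0) * indicator {0..D} s + (\<Sum>k<n. ennreal (s + ?c k) * indicator (?I k) s) \<partial>lborel)"
    unfolding area_def
  proof (intro nn_integral_mono)
    fix s :: real
    show "ennreal (age db (beu_policy d db \<omega>) s) * indicator {0..T} s \<le>
      ennreal (s + 0) * indicator {0..D} s + (\<Sum>k<n. ennreal (s + ?c k) * indicator (?I k) s)"
    proof (cases "s \<in> {0..T}")
      case True
      show ?thesis
      proof (cases "s \<le> D")
        case True
        then show ?thesis
          using \<open>s \<in> {0..T}\<close> age0[of s] by (auto intro!: add_increasing2 sum_nonneg ennreal_leI)
      next
        case False
        then obtain k where k: "k < n" "D + real k * p < s" "s \<le> D + real (Suc k) * p"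
          using slot_cover[of D s n p] assms(5) \<open>s \<in> {0..T}\<close> by auto
        have "ennreal (age db (beu_policy d db \<omega>) s) \<le> ennreal (s + ?c k)"
          using age_beu_le[OF assms(3,4), of k s \<omega>] k(2) by (intro ennreal_leI) (simp add: D_def p_def)
        also have "\<dots> = ennreal (s + ?c k) * indicator (?I k) s"
          using k by simp
        also have "\<dots> \<le> (\<Sum>k<n. ennreal (s + ?c k) * indicator (?I k) s)"
          using k(1) by (intro member_le_sum) auto
        finally show ?thesis
          using True by (auto intro: add_increasing)
      qed
    qed simp
  qed
  also have "\<dots> = (\<integral>\<^sup>+s. ennreal (s + 0) * indicator {0..D} s \<partial>lborel) +
      (\<Sum>k<n. \<integral>\<^sup>+s. ennreal (s + ?c k) * indicator (?I k) s \<partial>lborel)"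
  proof (subst nn_integral_add)
    have meas: "(\<lambda>s. ennreal (s + ?c k) * indicator (?I k) s) \<in> borel_measurable lborel" for k
      by (rule borel_measurable_times_ennreal) auto
    then show "(\<lambda>s. \<Sum>k<n. ennreal (s + ?c k) * indicator (?I k) s) \<in> borel_measurable lborel"
      by (rule borel_measurable_sum)
    show "(\<integral>\<^sup>+s. ennreal (s + 0) * indicator {0..D} s \<partial>lborel) +
        (\<integral>\<^sup>+s. (\<Sum>k<n. ennreal (s + ?c k) * indicator (?I k) s) \<partial>lborel) =
      (\<integral>\<^sup>+s. ennreal (s + 0) * indicator {0..D} s \<partial>lborel) +
        (\<Sum>k<n. \<integral>\<^sup>+s. ennreal (s + ?c k) * indicator (?I k) s \<partial>lborel)"
      by (simp only: nn_integral_sum[OF meas])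
  qed simp
  \<comment> \<open>The line starts slot \<open>k\<close> at height \<open>D\<close> plus
    \<open>p\<close> times the gap, so the trapezoid over length \<open>p\<close> has area p D +
    p^2/2 + p^2 times the gap.\<close>
  also have "\<dots> = ennreal (D\<^sup>2 / 2) + (\<Sum>k<n. ennreal (p * D + p\<^sup>2 / 2 + p\<^sup>2 * real (beu_gap p \<omega> k)))"
  proof (intro arg_cong2[where f="(+)"] sum.cong refl)
    show "(\<integral>\<^sup>+s. ennreal (s + 0) * indicator {0..D} s \<partial>lborel) = ennreal (D\<^sup>2 / 2)"
      using D by (subst nn_integral_ramp) auto
    fix k
    have "(D + real (Suc k) * p + ?c k)\<^sup>2 - (D + real k * p + ?c k)\<^sup>2 =
        2 * (p * D + p\<^sup>2 / 2 + p\<^sup>2 * real (beu_gap p \<omega> k))"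
      by (simp add: power2_eq_square algebra_simps)
    then have "((D + real (Suc k) * p + ?c k)\<^sup>2 - (D + real k * p + ?c k)\<^sup>2) / 2 =
        p * D + p\<^sup>2 / 2 + p\<^sup>2 * real (beu_gap p \<omega> k)"
      by (simp only:) simp
    moreover have "0 \<le> D + real k * p + ?c k"
      using D p by simp
    ultimately show "(\<integral>\<^sup>+s. ennreal (s + ?c k) * indicator (?I k) s \<partial>lborel) =
        ennreal (p * D + p\<^sup>2 / 2 + p\<^sup>2 * real (beu_gap p \<omega> k))"
      using le[of k] by (simp only: nn_integral_ramp add_left_mono)
  qed
  also have "\<dots> = ennreal (D\<^sup>2 / 2 + (\<Sum>k<n. p * D + p\<^sup>2 / 2 + p\<^sup>2 * real (beu_gap p \<omega> k)))"
    using D p by (subst sum_ennreal) (auto simp: ennreal_plus[symmetric] sum_nonneg simp del: ennreal_plus)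
  also have "\<dots> = ennreal (D\<^sup>2 / 2 + real n * (p * D + p\<^sup>2 / 2) + p\<^sup>2 * (\<Sum>k<n. real (beu_gap p \<omega> k)))"
    by (simp add: sum.distrib sum_distrib_left algebra_simps)
  also have "\<dots> = ennreal (D\<^sup>2 / 2 + real n * (p * D + p\<^sup>2 / 2)) + ennreal (p\<^sup>2) * ennreal (\<Sum>k<n. real (beu_gap p \<omega> k))"
    using D p by (simp add: ennreal_plus ennreal_mult sum_nonneg)
  finally show ?thesis .
qed

lemma ennreal_divide_le_of_le_mult:
  assumes "A \<le> ennreal (c * T)" "0 < T" "0 \<le> c"
  shows "A / ennreal T \<le> ennreal c"
proof -
  have "A / ennreal T \<le> ennreal (c * T) / ennreal T"
    using assms(1) by (rule divide_right_mono_ennreal)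
  also have "\<dots> = ennreal c"
    using assms by (subst divide_ennreal) auto
  finally show ?thesis .
qed

lemma avg_age_beu_le:
  fixes d db :: real
  defines "D \<equiv> d + db"
  defines "p \<equiv> max 1 D"
  assumes "0 < d" "0 < db"
  shows "avg_age db (beu_policy d db) \<le> ennreal (D + p / 2)"
proof (rule ennreal_le_epsilon)
  fix e :: real assume e: "0 < e"
  have D: "0 < D" and p: "1 \<le> p"
    using assms by auto
  \<comment> \<open>Gaps add at most \<open>p\<^sup>2 * \<eta>\<close> of expected area per slot on
    average, hence \<open>p * \<eta> = e / 2\<close> per unit of time.\<close>
  define \<eta> where "\<eta> = e / (2 * p)"
  have "0 < \<eta>"
    using e p by (simp add: \<eta>_def)
  \<comment> \<open>The number of slots needed to cover \<open>T\<close>; the overshoot is at most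
    one slot and costs at most \<open>C\<close>, which vanishes after division by
    \<open>T\<close>.\<close>
  define N where "N T = nat \<lceil>T / p\<rceil>" for T
  define C where "C = p * D + p\<^sup>2 / 2 + p\<^sup>2 * \<eta>"
  have "filterlim N sequentially at_top"
    unfolding filterlim_at_top
  proof
    fix Z
    show "\<forall>\<^sub>F T in at_top. Z \<le> N T"
      using eventually_ge_at_top[of "real Z * p"]
    proof eventually_elim
      case (elim T)
      then have "real Z \<le> T / p"
        using p by (simp add: field_simps)
      then show ?case
        unfolding N_def by linarith
    qed
  qed
  from eventually_compose_filterlim[OF eventually_sum_beu_gap_le[OF p \<open>0 < \<eta>\<close>] this]
  have ev: "\<forall>\<^sub>F T in at_top. (\<integral>\<^sup>+\<omega>. ennreal (\<Sum>k<N T. real (beu_gap p \<omega> k)) \<partial>Omega) \<le> ennreal (\<eta> * real (N T))" .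
  have "((\<lambda>T::real. (D\<^sup>2 / 2 + C) / T) \<longlongrightarrow> 0) at_top"
    by (intro tendsto_divide_0[OF tendsto_const] filterlim_at_top_imp_at_infinity filterlim_ident)
  then have "\<forall>\<^sub>F T in at_top. (D\<^sup>2 / 2 + C) / T < e / 2"
    using e by (intro order_tendstoD(2)) auto
  with ev eventually_gt_at_top[of 0]
  have "\<forall>\<^sub>F T in at_top. (\<integral>\<^sup>+\<omega>. area db (beu_policy d db \<omega>) T \<partial>Omega) / ennreal T \<le> ennreal (D + p / 2 + e)"
  proof eventually_elim
    case (elim T)
    have N: "T \<le> real (N T) * p" "real (N T) * p \<le> T + p"
    proof -
      have "T / p \<le> real (N T)" "real (N T) \<le> T / p + 1"
        using elim(2) p divide_nonneg_nonneg[of T p] unfolding N_def by linarith+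
      then show "T \<le> real (N T) * p" "real (N T) * p \<le> T + p"
        using p by (auto simp: field_simps)
    qed
    have "(\<integral>\<^sup>+\<omega>. area db (beu_policy d db \<omega>) T \<partial>Omega) \<le>
       (\<integral>\<^sup>+\<omega>. ennreal (D\<^sup>2 / 2 + real (N T) * (p * D + p\<^sup>2 / 2)) +
         ennreal (p\<^sup>2) * ennreal (\<Sum>k<N T. real (beu_gap p \<omega> k)) \<partial>Omega)"
      using N(1) D area_beu_le[OF assms(3,4), of T "N T"] by (intro nn_integral_mono) (auto simp: D_def p_def)
    also have "\<dots> = ennreal (D\<^sup>2 / 2 + real (N T) * (p * D + p\<^sup>2 / 2)) +
         ennreal (p\<^sup>2) * (\<integral>\<^sup>+\<omega>. ennreal (\<Sum>k<N T. real (beu_gap p \<omega> k)) \<partial>Omega)"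
      by (simp add: nn_integral_add nn_integral_cmult Omega.emeasure_space_1[simplified])
    also have "\<dots> \<le> ennreal (D\<^sup>2 / 2 + real (N T) * (p * D + p\<^sup>2 / 2)) + ennreal (p\<^sup>2) * ennreal (\<eta> * real (N T))"
      using elim(1) by (intro add_mono mult_left_mono) auto
    also have "\<dots> = ennreal (D\<^sup>2 / 2 + real (N T) * C)"
      using D p \<open>0 < \<eta>\<close>
      by (simp add: ennreal_plus[symmetric] ennreal_mult[symmetric] C_def algebra_simps del: ennreal_plus)
    also have "\<dots> \<le> ennreal ((D + p / 2 + e) * T)"
    proof (intro ennreal_leI)
      have "real (N T) * C = real (N T) * p * (D + p / 2 + p * \<eta>)"
        by (simp add: C_def power2_eq_square algebra_simps)
      also have "\<dots> \<le> (T + p) * (D + p / 2 + p * \<eta>)"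
        using N(2) D p \<open>0 < \<eta>\<close> by (intro mult_right_mono) auto
      also have "\<dots> = T * (D + p / 2 + e / 2) + C"
        using p by (simp add: C_def \<eta>_def power2_eq_square field_simps)
      finally have "D\<^sup>2 / 2 + real (N T) * C \<le> T * (D + p / 2 + e / 2) + (D\<^sup>2 / 2 + C)"
        by simp
      moreover have "D\<^sup>2 / 2 + C \<le> T * (e / 2)"
        using elim(2,3) by (simp add: field_simps)
      ultimately show "D\<^sup>2 / 2 + real (N T) * C \<le> (D + p / 2 + e) * T"
        by (simp add: algebra_simps)
    qed
    finally show ?case
      using elim(2) D p e by (intro ennreal_divide_le_of_le_mult) auto
  qed
  then have "avg_age db (beu_policy d db) \<le> ennreal (D + p / 2 + e)"
    unfolding avg_age_def by (rule Limsup_bounded)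
  then show "avg_age db (beu_policy d db) \<le> ennreal (D + p / 2) + ennreal e"
    using D p e by (simp add: ennreal_plus)
qed

section \<open>Lower bounds for every feasible policy\<close>

text \<open>For nondecreasing \<open>t\<close>, the last of the first \<open>n\<close> transmission
  times not after \<open>s\<close>. The default 0 matches the initial age, and recursion from the
  top index lets an induction remove the last transmission.\<close>

primrec latest :: "(nat \<Rightarrow> ereal) \<Rightarrow> nat \<Rightarrow> real \<Rightarrow> real" where
  "latest t 0 s = 0"
| "latest t (Suc n) s = (if t n \<le> ereal s then real_of_ereal (t n) else latest t n s)"

lemma measurable_latest [measurable (raw)]:
  assumes [measurable]: "f \<in> borel_measurable M"
  shows "(\<lambda>x. latest t n (f x)) \<in> borel_measurable M"
proof (induction n)
  case (Suc n)
  note [measurable] = this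
  show ?case
    by simp
qed simp

lemma measurable_ramp_latest:
  "(\<lambda>s. ennreal (s - latest t n s) * indicator {a..b} s) \<in> borel_measurable lborel"
  by (intro borel_measurable_times_ennreal measurable_compose[OF _ measurable_ennreal]
      borel_measurable_diff measurable_latest borel_measurable_indicator) auto

lemma latest_le:
  assumes "\<And>i. 0 \<le> t i" "0 \<le> s"
  shows "latest t n s \<le> s"
proof (induction n)
  case (Suc n)
  then show ?case
    using assms(1)[of n] by (cases "t n") auto
qed (use assms in simp)

lemma latest_nonneg:
  assumes "\<And>i. 0 \<le> t i"
  shows "0 \<le> latest t n s"
  by (induction n) (auto simp: real_of_ereal_pos assms)

lemma le_latest:
  assumes "incseq t" "\<And>i. 0 \<le> t i" "i < n" "t i \<le> ereal s"
  shows "real_of_ereal (t i) \<le> latest t n s"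
  using assms(3)
proof (induction n)
  case (Suc n)
  have "t i \<le> t n"
    using assms(1) Suc.prems by (simp add: incseq_def)
  then have "real_of_ereal (t i) \<le> real_of_ereal (t n)" if "t n \<le> ereal s"
    using that assms(2)[of i] assms(2)[of n] by (cases "t i"; cases "t n") auto
  then show ?case
    using Suc assms(4) by (cases "i = n") auto
qed simp

text \<open>\<open>ennreal\<close> truncates negative numbers to 0, so splitting a sum whose terms
  may be negative only gives an inequality.\<close>

lemma ennreal_add_le: "ennreal (a + b) \<le> ennreal a + ennreal b"
proof -
  have "ennreal (a + b) \<le> ennreal (max 0 a + max 0 b)"
    by (intro ennreal_leI) simp
  also have "\<dots> = ennreal (max 0 a) + ennreal (max 0 b)"
    by (rule ennreal_plus) auto
  also have "\<dots> = ennreal a + ennreal b"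
    by (simp add: max_def ennreal_neg)
  finally show ?thesis .
qed

text \<open>Each of the at most \<open>n + 1\<close> intervals between transmissions contributes half the square of
  its length, which is bounded below by its tangent at \<open>c\<close>.\<close>

lemma nn_integral_latest_ge:
  assumes "incseq t" "\<And>i. 0 \<le> t i" "0 \<le> x"
  shows "ennreal (c * x - real (n + 1) * (c\<^sup>2 / 2)) \<le>
    (\<integral>\<^sup>+s. ennreal (s - latest t n s) * indicator {0..x} s \<partial>lborel)"
  using assms(3)
proof (induction n arbitrary: x)
  case 0
  have "0 \<le> (x - c)\<^sup>2"
    by simp
  then have "c * x - c\<^sup>2 / 2 \<le> x\<^sup>2 / 2"
    by (simp add: power2_eq_square algebra_simps)
  then show ?case
    using nn_integral_ramp[of 0 0 x] 0 by (simp add: ennreal_leI)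
next
  case (Suc n)
  show ?case
  proof (cases "t n < ereal x")
    \<comment> \<open>The integral is split at the last transmission \<open>u\<close>: the induction
      hypothesis covers [0, u], and the remaining interval of length y = x - u uses y^2/2 \<ge> c y
      - c^2/2.\<close>
    case True
    then obtain u where u: "t n = ereal u" "0 \<le> u" "u < x"
      using assms(2)[of n] by (cases "t n") auto
    have "c * x - real (Suc n + 1) * (c\<^sup>2 / 2) =
        (c * u - real (n + 1) * (c\<^sup>2 / 2)) + (c * (x - u) - c\<^sup>2 / 2)"
      by (simp add: algebra_simps add_divide_distrib)
    also have "ennreal \<dots> \<le> ennreal (c * u - real (n + 1) * (c\<^sup>2 / 2)) + ennreal (c * (x - u) - c\<^sup>2 / 2)"
      by (rule ennreal_add_le)
    also have "\<dots> \<le> (\<integral>\<^sup>+s. ennreal (s - latest t n s) * indicator {0..u} s \<partial>lborel) +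
        (\<integral>\<^sup>+s. ennreal (s + (- u)) * indicator {u..x} s \<partial>lborel)"
    proof (intro add_mono Suc.IH u(2))
      have "0 \<le> (x - u - c)\<^sup>2"
        by simp
      then have "c * (x - u) - c\<^sup>2 / 2 \<le> (x - u)\<^sup>2 / 2"
        by (simp add: power2_eq_square algebra_simps)
      then show "ennreal (c * (x - u) - c\<^sup>2 / 2) \<le> (\<integral>\<^sup>+s. ennreal (s + (- u)) * indicator {u..x} s \<partial>lborel)"
        using u by (subst nn_integral_ramp) (auto intro: ennreal_leI)
    qed
    also have "\<dots> = (\<integral>\<^sup>+s. ennreal (s - latest t n s) * indicator {0..u} s +
        ennreal (s + (- u)) * indicator {u..x} s \<partial>lborel)"
      by (rule nn_integral_add[symmetric]) (simp_all add: measurable_ramp_latest)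
    also have "\<dots> \<le> (\<integral>\<^sup>+s. ennreal (s - latest t (Suc n) s) * indicator {0..x} s \<partial>lborel)"
    proof (rule nn_integral_mono_AE)
      show "AE s in lborel. ennreal (s - latest t n s) * indicator {0..u} s +
          ennreal (s + (- u)) * indicator {u..x} s \<le> ennreal (s - latest t (Suc n) s) * indicator {0..x} s"
        using AE_lborel_singleton[of u]
        by eventually_elim (use u in \<open>auto simp: indicator_def\<close>)
    qed
    finally show ?thesis .
  next
    \<comment> \<open>Transmission \<open>n\<close> is not before \<open>x\<close>, so it does not
      affect \<open>latest\<close> below \<open>x\<close>, and the claimed bound is weaker than that
      for \<open>n\<close>.\<close>
    case False
    have "ennreal (c * x - real (Suc n + 1) * (c\<^sup>2 / 2)) \<le> ennreal (c * x - real (n + 1) * (c\<^sup>2 / 2))"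
      by (intro ennreal_leI) (simp add: algebra_simps)
    also have "\<dots> \<le> (\<integral>\<^sup>+s. ennreal (s - latest t n s) * indicator {0..x} s \<partial>lborel)"
      by (rule Suc.IH[OF Suc.prems])
    also have "\<dots> \<le> (\<integral>\<^sup>+s. ennreal (s - latest t (Suc n) s) * indicator {0..x} s \<partial>lborel)"
    proof (rule nn_integral_mono_AE)
      show "AE s in lborel. ennreal (s - latest t n s) * indicator {0..x} s \<le>
          ennreal (s - latest t (Suc n) s) * indicator {0..x} s"
        using AE_lborel_singleton[of x]
      proof eventually_elim
        case (elim s)
        show ?case
        proof (cases "s < x")
          case True
          then have "\<not> t n \<le> ereal s"
            using False by (metis less_ereal.simps(1) less_le_trans not_less)
          then show ?thesis
            by simp
        qed (use elim in \<open>simp add: indicator_def\<close>)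
      qed
    qed
    finally show ?thesis .
  qed
qed

lemma incseq_transmissions:
  assumes "feasible_sched d db \<omega> S" "0 < d" "0 < db"
  shows "fst S i + ereal (d + db) \<le> fst S (Suc i)" "incseq (fst S)"
proof -
  show *: "fst S i + ereal (d + db) \<le> fst S (Suc i)" for i
  proof -
    have "fst S i + ereal d \<le> snd S i" "snd S i + ereal db \<le> fst S (Suc i)"
      using assms(1) by (auto simp: feasible_sched_def)
    then show ?thesis
      by (cases "fst S i"; cases "snd S i"; cases "fst S (Suc i)") auto
  qed
  have "fst S i \<le> fst S (Suc i)" for i
    using *[of i] assms(2,3) by (cases "fst S i"; cases "fst S (Suc i)") auto
  then show "incseq (fst S)"
    by (rule incseq_SucI)
qed

text \<open>An update received before \<open>s\<close> was sent before \<open>s - (d + db)\<close>,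
  and the last hypothesis puts its index among the first \<open>n\<close>.\<close>

lemma upd_gen_le_latest:
  assumes "feasible_sched d db \<omega> S" "0 < d" "0 < db" "s \<le> x + (d + db)"
    and "\<And>i. fst S i \<le> ereal x \<Longrightarrow> i < n"
  shows "upd_gen db S s \<le> latest (fst S) n (s - (d + db))"
  unfolding upd_gen_def
proof (rule cSup_least)
  note nonneg = feasible_sched_nonneg[OF assms(1-3)]
  fix y assume "y \<in> {0} \<union> {real_of_ereal (fst S i) |i. snd S i + ereal db < ereal s}"
  then consider "y = 0" | i where "y = real_of_ereal (fst S i)" "snd S i + ereal db < ereal s"
    by auto
  then show "y \<le> latest (fst S) n (s - (d + db))"
  proof cases
    case (2 i)
    from 2(2) obtain u where u: "fst S i = ereal u" "0 \<le> u" "u + (d + db) < s"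
      using received_imp_sent[OF assms(1-3)] by metis
    then have "i < n"
      using assms(4) by (intro assms(5)) auto
    then show ?thesis
      using u le_latest[OF incseq_transmissions(2)[OF assms(1-3)] nonneg, of i n "s - (d + db)"] 2(1)
      by simp
  qed (simp add: latest_nonneg nonneg)
qed simp

text \<open>At time \<open>s + (d + db)\<close> the age is at least \<open>d + db\<close> plus the
  time from the latest transmission to \<open>s\<close>. The constant part contributes
  \<open>(d + db) * x\<close>; the area before time \<open>d + db\<close> is dropped.\<close>

lemma area_ge:
  assumes "feasible_sched d db \<omega> S" "0 < d" "0 < db" "0 \<le> x" "T = x + (d + db)"
    and "\<And>i. fst S i \<le> ereal x \<Longrightarrow> i < n"
  shows "ennreal ((d + db) * x + c * x - real (n + 1) * (c\<^sup>2 / 2)) \<le> area db S T"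
proof -
  let ?D = "d + db"
  note nonneg = feasible_sched_nonneg[OF assms(1-3)]
  have "ennreal (?D * x + c * x - real (n + 1) * (c\<^sup>2 / 2)) \<le>
      ennreal (?D * x) + ennreal (c * x - real (n + 1) * (c\<^sup>2 / 2))"
    using ennreal_add_le[of "?D * x" "c * x - real (n + 1) * (c\<^sup>2 / 2)"] by (simp add: add_diff_eq)
  also have "\<dots> \<le> (\<integral>\<^sup>+s. ennreal ?D * indicator {0..x} s \<partial>lborel) +
     (\<integral>\<^sup>+s. ennreal (s - latest (fst S) n s) * indicator {0..x} s \<partial>lborel)"
    using assms(2-4) nn_integral_latest_ge[OF incseq_transmissions(2)[OF assms(1-3)] nonneg assms(4)]
    by (intro add_mono) (simp_all add: nn_integral_cmult_indicator ennreal_mult)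
  also have "\<dots> = (\<integral>\<^sup>+s. ennreal ?D * indicator {0..x} s +
      ennreal (s - latest (fst S) n s) * indicator {0..x} s \<partial>lborel)"
    by (rule nn_integral_add[symmetric]) (simp_all add: measurable_ramp_latest)
  \<comment> \<open>Written with \<open>?D + 1 * s\<close> to fit the affine substitution rule that
    undoes the shift by the service delay.\<close>
  also have "\<dots> \<le> (\<integral>\<^sup>+s. ennreal (?D + 1 * s - latest (fst S) n (?D + 1 * s - ?D)) * indicator {?D..T} (?D + 1 * s) \<partial>lborel)"
  proof (intro nn_integral_mono)
    fix s :: real
    have "0 \<le> s - latest (fst S) n s" if "0 \<le> s"
      using latest_le[where n=n, OF nonneg that] by simp
    then show "ennreal ?D * indicator {0..x} s + ennreal (s - latest (fst S) n s) * indicator {0..x} s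
      \<le> ennreal (?D + 1 * s - latest (fst S) n (?D + 1 * s - ?D)) * indicator {?D..T} (?D + 1 * s)"
      using assms(2,3,5)
      by (auto simp: indicator_def ennreal_plus[symmetric] add_diff_eq algebra_simps simp del: ennreal_plus)
  qed
  also have "\<dots> = (\<integral>\<^sup>+s. ennreal (s - latest (fst S) n (s - ?D)) * indicator {?D..T} s \<partial>lborel)"
    by (subst nn_integral_real_affine[where c=1 and t="?D",
          of "\<lambda>s. ennreal (s - latest (fst S) n (s - ?D)) * indicator {?D..T} s"])
      (auto intro!: borel_measurable_times_ennreal measurable_compose[OF _ measurable_ennreal]
        borel_measurable_diff measurable_latest borel_measurable_indicator)
  also have "\<dots> \<le> area db S T"
    unfolding area_def
  proof (intro nn_integral_mono)
    fix s :: real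
    show "ennreal (s - latest (fst S) n (s - ?D)) * indicator {?D..T} s \<le> ennreal (age db S s) * indicator {0..T} s"
      using upd_gen_le_latest[OF assms(1-3), of s x n] assms(2,3,5,6)
      by (auto simp: indicator_def age_def intro!: ennreal_leI)
  qed
  finally show ?thesis .
qed

lemma divide_ennreal_ge_of_le:
  assumes "ennreal (c * T) \<le> A" "0 < T" "0 \<le> c"
  shows "ennreal c \<le> A / ennreal T"
proof -
  have "ennreal c = ennreal (c * T) / ennreal T"
    using assms by (subst divide_ennreal) auto
  also have "\<dots> \<le> A / ennreal T"
    using assms(1) by (rule divide_right_mono_ennreal)
  finally show ?thesis .
qed

lemma avg_age_ge_of_tendsto:
  assumes "\<forall>\<^sub>F T in at_top. ennreal (f T * T) \<le> (\<integral>\<^sup>+\<omega>. area db (\<pi> \<omega>) T \<partial>Omega)"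
    and "(f \<longlongrightarrow> a) at_top" "0 < a"
  shows "ennreal a \<le> avg_age db \<pi>"
proof -
  have "((\<lambda>T. ennreal (f T)) \<longlongrightarrow> ennreal a) at_top"
    using assms(2) by (rule tendsto_ennrealI)
  then have "ennreal a = Limsup at_top (\<lambda>T. ennreal (f T))"
    by (rule lim_imp_Limsup[OF trivial_limit_at_top_linorder, symmetric])
  also have "\<dots> \<le> avg_age db \<pi>"
    unfolding avg_age_def
  proof (rule Limsup_mono)
    show "\<forall>\<^sub>F T in at_top. ennreal (f T) \<le> (\<integral>\<^sup>+\<omega>. area db (\<pi> \<omega>) T \<partial>Omega) / ennreal T"
      using assms(1) eventually_gt_at_top[of 0] order_tendstoD(1)[OF assms(2,3)]
      by eventually_elim (auto intro: divide_ennreal_ge_of_le)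
  qed
  finally show ?thesis .
qed

section \<open>The service bound\<close>

lemma avg_age_ge_service:
  assumes "feasible d db \<pi>" "0 < d" "0 < db"
  shows "ennreal (3 / 2 * (d + db)) \<le> avg_age db \<pi>"
proof (rule avg_age_ge_of_tendsto)
  let ?D = "d + db"
  have D: "0 < ?D"
    using assms by simp
  \<comment> \<open>The correction comes from inserting n D \<le> x + D and x = T - D: 2 D x - (n +
    1) D^2/2 \<ge> (3/2) D x - D^2 = (3/2) D T - (5/2) D^2.\<close>
  have "((\<lambda>T::real. 3 / 2 * ?D - (5 / 2 * ?D\<^sup>2) / T) \<longlongrightarrow> 3 / 2 * ?D - 0) at_top"
    by (intro tendsto_diff tendsto_const tendsto_divide_0[OF tendsto_const]
        filterlim_at_top_imp_at_infinity filterlim_ident)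
  then show "((\<lambda>T::real. 3 / 2 * ?D - (5 / 2 * ?D\<^sup>2) / T) \<longlongrightarrow> 3 / 2 * ?D) at_top"
    by simp
  show "0 < 3 / 2 * ?D"
    using D by simp
  show "\<forall>\<^sub>F T in at_top. ennreal ((3 / 2 * ?D - (5 / 2 * ?D\<^sup>2) / T) * T) \<le>
    (\<integral>\<^sup>+\<omega>. area db (\<pi> \<omega>) T \<partial>Omega)"
    using eventually_gt_at_top[of ?D]
  proof eventually_elim
    case (elim T)
    define x where "x = T - ?D"
    \<comment> \<open>Transmission \<open>i\<close> is not before \<open>real i * ?D\<close>, so the
      indices of those up to \<open>x\<close> run from 0 to the floor of
      \<open>x / ?D\<close>.\<close>
    define n where "n = Suc (nat \<lfloor>x / ?D\<rfloor>)"
    have x: "0 < x" "T = x + ?D"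
      using elim by (auto simp: x_def)
    have "real n \<le> x / ?D + 1"
      using x D divide_nonneg_nonneg[of x ?D] unfolding n_def by linarith
    then have "real n * ?D \<le> x + ?D"
      using D by (simp add: field_simps)
    then have "real n * ?D * ?D \<le> (x + ?D) * ?D"
      using D by (intro mult_right_mono) auto
    moreover have "3 / 2 * a * (x + a) - 5 / 2 * a\<^sup>2 \<le> a * x + a * x - real (n + 1) * (a\<^sup>2 / 2)"
      if "real n * a * a \<le> (x + a) * a" for a
      using that by (simp add: power2_eq_square field_simps)
    moreover have "(3 / 2 * ?D - (5 / 2 * ?D\<^sup>2) / T) * T = 3 / 2 * ?D * (x + ?D) - 5 / 2 * ?D\<^sup>2"
      using elim D unfolding x(2)[symmetric] left_diff_distrib by simp
    ultimately have "(3 / 2 * ?D - (5 / 2 * ?D\<^sup>2) / T) * T \<le> ?D * x + ?D * x - real (n + 1) * (?D\<^sup>2 / 2)"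
      by presburger
    then have "ennreal ((3 / 2 * ?D - (5 / 2 * ?D\<^sup>2) / T) * T) \<le>
       (\<integral>\<^sup>+\<omega>. ennreal (?D * x + ?D * x - real (n + 1) * (?D\<^sup>2 / 2)) \<partial>Omega)"
      by (simp add: Omega.emeasure_space_1[simplified] ennreal_leI)
    also have "\<dots> \<le> (\<integral>\<^sup>+\<omega>. area db (\<pi> \<omega>) T \<partial>Omega)"
    proof (intro nn_integral_mono)
      fix \<omega>
      have S: "feasible_sched d db \<omega> (\<pi> \<omega>)"
        using assms(1) unfolding feasible_def by blast
      have "ereal (real i * ?D) \<le> fst (\<pi> \<omega>) i" for i
      proof (induction i)
        case (Suc i)
        then show ?case
          using incseq_transmissions(1)[OF S assms(2,3), of i]
          by (cases "fst (\<pi> \<omega>) i"; cases "fst (\<pi> \<omega>) (Suc i)") (auto simp: algebra_simps)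
      qed (use feasible_sched_nonneg[OF S assms(2,3)] in \<open>simp add: zero_ereal_def[symmetric]\<close>)
      then have le: "real i * ?D \<le> x" if "fst (\<pi> \<omega>) i \<le> ereal x" for i
        using that by (metis ereal_less_eq(3) order_trans)
      have "i < n" if "fst (\<pi> \<omega>) i \<le> ereal x" for i
      proof -
        have "real i \<le> x / ?D"
          using le[OF that] D by (simp add: field_simps)
        then show ?thesis
          unfolding n_def by linarith
      qed
      then show "ennreal (?D * x + ?D * x - real (n + 1) * (?D\<^sup>2 / 2)) \<le> area db (\<pi> \<omega>) T"
        using x by (intro area_ge[OF S assms(2,3)]) auto
    qed
    finally show ?case .
  qed
qed

section \<open>The energy bound\<close>

text \<open>If arrival \<open>q\<close> comes after \<open>x\<close>, only the \<open>q\<close>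
  earlier ones can supply energy up to \<open>x\<close>; with the initial packet this allows
  \<open>q + 1\<close> transmissions.\<close>

lemma transmissions_less_of_arr_time:
  assumes "feasible_sched d db \<omega> S" "0 < d" "0 < db" "\<And>i. 0 \<le> fst \<omega> i" "x < arr_time (fst \<omega>) q"
    and "fst S i \<le> ereal x"
  shows "i < Suc q"
proof (rule ccontr)
  assume "\<not> i < Suc q"
  obtain u where u: "fst S i = ereal u" "u \<le> x"
    using assms(6) feasible_sched_nonneg[OF assms(1-3), of i] by (cases "fst S i") auto
  then have "enat i \<le> N_before (fst \<omega>) u"
    using assms(1) by (auto simp: feasible_sched_def dest: spec[of _ i])
  then obtain F where F: "finite F" "card F = i" "\<forall>k\<in>F. arr_time (fst \<omega>) k < u"
    by (auto simp: enat_le_N_before_iff)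
  have "\<not> F \<subseteq> {..<q}"
    using card_mono[of "{..<q}" F] F(2) \<open>\<not> i < Suc q\<close> by auto
  then obtain k where k: "k \<in> F" "q \<le> k"
    by (auto simp: subset_iff not_less)
  have "arr_time (fst \<omega>) q \<le> arr_time (fst \<omega>) k"
    unfolding arr_time_def using k(2) assms(4) by (intro sum_mono2) auto
  then show False
    using F(3) k(1) u(2) assms(5) by force
qed

lemma AE_Omega_fst_nonneg: "AE \<omega> in Omega. \<forall>i. 0 \<le> fst \<omega> i"
proof -
  have "distr Omega gaps fst = gaps"
    unfolding Omega_eq by (rule gaps.distr_pair_fst)
  then have "AE x in distr Omega gaps fst. \<forall>i. 0 \<le> x i"
    by (simp only: AE_gaps_nonneg)
  then show ?thesis
    by (rule AE_distrD[OF measurable_fst_Omega])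
qed

text \<open>Arrival \<open>q\<close> has mean \<open>q + 1\<close>, which exceeds \<open>x\<close>
  by at least \<open>\<eta> * x\<close>, so coming by \<open>x\<close> is a large deviation. From q
  + 1 \<le> 4 x the constant is 9 * 16 = 144, and the resulting x^2 in the denominator is weakened
  to \<open>x\<close>.\<close>

lemma emeasure_arr_time_greater:
  assumes "0 < \<eta>" "\<eta> \<le> 1" "1 \<le> x"
  shows "ennreal (1 - 144 / \<eta> ^ 4 / x) \<le> emeasure gaps {X. x < arr_time X (nat \<lceil>(1 + \<eta>) * x\<rceil>)}"
proof -
  define q where "q = nat \<lceil>(1 + \<eta>) * x\<rceil>"
  have q: "(1 + \<eta>) * x \<le> real q" "real q \<le> (1 + \<eta>) * x + 1"
    using assms mult_nonneg_nonneg[of "1 + \<eta>" x] unfolding q_def by linarith+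
  have "(1 + \<eta>) * x \<le> 2 * x"
    using assms by (intro mult_right_mono) auto
  then have q4: "real (Suc q) \<le> 4 * x"
    using q(2) assms(3) by linarith
  have dev: "0 < \<eta> * x" "\<eta> * x \<le> real (Suc q) - x"
    using q(1) assms by (auto simp: algebra_simps)
  have [measurable]: "{X. x < arr_time X q} \<in> sets gaps" "{X. arr_time X q \<le> x} \<in> sets gaps"
    "{X. \<eta> * x \<le> \<bar>arr_time X q - real (Suc q)\<bar>} \<in> sets gaps"
  proof -
    have "{X\<in>space gaps. x < arr_time X q} \<in> sets gaps" "{X\<in>space gaps. arr_time X q \<le> x} \<in> sets gaps"
      "{X\<in>space gaps. \<eta> * x \<le> \<bar>arr_time X q - real (Suc q)\<bar>} \<in> sets gaps"
      by measurable
    then show "{X. x < arr_time X q} \<in> sets gaps" "{X. arr_time X q \<le> x} \<in> sets gaps"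
      "{X. \<eta> * x \<le> \<bar>arr_time X q - real (Suc q)\<bar>} \<in> sets gaps"
      by simp_all
  qed
  have "emeasure gaps {X. arr_time X q \<le> x} \<le> emeasure gaps {X. \<eta> * x \<le> \<bar>arr_time X q - real (Suc q)\<bar>}"
    using dev(2) by (intro emeasure_mono) (auto simp del: of_nat_Suc)
  also have "\<dots> \<le> ennreal (9 * real (Suc q) ^ 2 / (\<eta> * x) ^ 4)"
    by (rule arr_time_deviation[OF dev(1)])
  also have "\<dots> \<le> ennreal (144 / \<eta> ^ 4 / x)"
  proof (intro ennreal_leI)
    have "9 * real (Suc q) ^ 2 / (\<eta> * x) ^ 4 \<le> 9 * (4 * x) ^ 2 / (\<eta> * x) ^ 4"
      using q4 assms by (intro divide_right_mono mult_left_mono power_mono) auto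
    also have "\<dots> = 144 / \<eta> ^ 4 / x / x"
      using assms by (simp add: field_simps eval_nat_numeral)
    also have "\<dots> \<le> 144 / \<eta> ^ 4 / x / 1"
      using assms by (intro divide_left_mono) auto
    finally show "9 * real (Suc q) ^ 2 / (\<eta> * x) ^ 4 \<le> 144 / \<eta> ^ 4 / x"
      by simp
  qed
  finally have "gaps.prob {X. arr_time X q \<le> x} \<le> 144 / \<eta> ^ 4 / x"
    using assms by (simp add: gaps.emeasure_eq_measure)
  moreover have "gaps.prob {X. x < arr_time X q} = 1 - gaps.prob {X. arr_time X q \<le> x}"
  proof -
    have "{X. x < arr_time X q} = space gaps - {X. arr_time X q \<le> x}"
      by auto
    then show ?thesis
      by (simp only: gaps.prob_compl[OF \<open>{X. arr_time X q \<le> x} \<in> sets gaps\<close>])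
  qed
  ultimately show ?thesis
    unfolding q_def[symmetric] gaps.emeasure_eq_measure by (intro ennreal_leI) linarith
qed

lemma avg_age_ge_energy:
  assumes "feasible d db \<pi>" "0 < d" "0 < db"
  shows "ennreal (1 / 2 + d + db) \<le> avg_age db \<pi>"
proof (rule ennreal_le_epsilon)
  let ?D = "d + db"
  fix e :: real assume e: "0 < e"
  \<comment> \<open>The surplus \<open>\<eta>\<close> in the transmission rate lowers the bound by
    \<open>\<eta> / 2\<close>, which must not exceed \<open>e\<close>.\<close>
  define \<eta> where "\<eta> = min 1 (2 * e)"
  have \<eta>: "0 < \<eta>" "\<eta> \<le> 1" "\<eta> / 2 \<le> e"
    using e by (auto simp: \<eta>_def)
  define a where "a = ?D + 1 / 2 - \<eta> / 2"
  have a: "0 < a"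
    using assms \<eta> by (simp add: a_def)
  \<comment> \<open>With c = 1 and q \<le> (1 + \<eta>) x + 1, the area bound is at least a x - 3/2;
    substituting x = T - D gives a T - C.\<close>
  define C where "C = a * ?D + 3 / 2"
  define f where "f T = (a - C / T) * (1 - 144 / \<eta> ^ 4 / (T - ?D))" for T :: real
  have "ennreal a \<le> avg_age db \<pi>"
  proof (rule avg_age_ge_of_tendsto[OF _ _ a])
    have shift: "filterlim (\<lambda>T::real. T - ?D) at_infinity at_top"
      using filterlim_tendsto_add_at_top[OF tendsto_const[of "- ?D"] filterlim_ident]
      by (intro filterlim_at_top_imp_at_infinity) (simp only: uminus_add_conv_diff)
    have "(f \<longlongrightarrow> (a - 0) * (1 - 0)) at_top"
      unfolding f_def
      by (intro tendsto_intros tendsto_divide_0[OF tendsto_const] shift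
          filterlim_at_top_imp_at_infinity[OF filterlim_ident])
    then show "(f \<longlongrightarrow> a) at_top"
      by simp
    show "\<forall>\<^sub>F T in at_top. ennreal (f T * T) \<le> (\<integral>\<^sup>+\<omega>. area db (\<pi> \<omega>) T \<partial>Omega)"
      using eventually_ge_at_top[of "?D + max 1 (144 / \<eta> ^ 4)"]
    proof eventually_elim
      case (elim T)
      define x where "x = T - ?D"
      define q where "q = nat \<lceil>(1 + \<eta>) * x\<rceil>"
      define w where "w = (a - C / T) * T"
      have x: "1 \<le> x" "144 / \<eta> ^ 4 \<le> x" "T = x + ?D" "0 < T"
        using elim assms by (auto simp: x_def)
      have "real q \<le> (1 + \<eta>) * x + 1"
        using \<eta> x mult_nonneg_nonneg[of "1 + \<eta>" x] unfolding q_def by linarith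
      moreover have "w = a * T - C"
        using x by (simp add: w_def left_diff_distrib)
      then have "w = a * x - 3 / 2"
        using x by (simp add: C_def distrib_left)
      ultimately have w: "w \<le> ?D * x + 1 * x - real (Suc q + 1) * (1\<^sup>2 / 2)"
        by (simp add: a_def field_simps)
      have [measurable]: "{X. x < arr_time X q} \<in> sets gaps"
      proof -
        have "{X\<in>space gaps. x < arr_time X q} \<in> sets gaps"
          by measurable
        then show ?thesis
          by simp
      qed
      \<comment> \<open>\<open>w\<close> may be negative, so the product is split using only the
        sign of the probability bound, which is nonnegative as x \<ge> 144 / \<eta>^4.\<close>
      have "ennreal (f T * T) = ennreal w * ennreal (1 - 144 / \<eta> ^ 4 / x)"
      proof -
        have "144 / \<eta> ^ 4 / x \<le> 1"
          using x by (subst pos_divide_le_eq) auto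
        moreover have "f T * T = w * (1 - 144 / \<eta> ^ 4 / x)"
          unfolding f_def w_def x_def by simp
        ultimately show ?thesis
          by (simp add: ennreal_mult'')
      qed
      also have "\<dots> \<le> ennreal w * emeasure gaps {X. x < arr_time X q}"
        unfolding q_def using \<eta> x by (intro mult_left_mono emeasure_arr_time_greater) auto
      also have "\<dots> = (\<integral>\<^sup>+\<omega>. ennreal w * indicator {X. x < arr_time X q} (fst \<omega>) \<partial>Omega)"
        by (simp add: nn_integral_cmult nn_integral_Omega_fst)
      also have "\<dots> \<le> (\<integral>\<^sup>+\<omega>. area db (\<pi> \<omega>) T \<partial>Omega)"
      proof (rule nn_integral_mono_AE)
        \<comment> \<open>When arrival \<open>q\<close> comes late the area bound applies; otherwise
          the left side is 0. Nonnegative gaps, needed to order the arrivals, hold almost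
          surely.\<close>
        show "AE \<omega> in Omega. ennreal w * indicator {X. x < arr_time X q} (fst \<omega>) \<le> area db (\<pi> \<omega>) T"
          using AE_Omega_fst_nonneg
        proof eventually_elim
          case (elim \<omega>)
          have S: "feasible_sched d db \<omega> (\<pi> \<omega>)"
            using assms(1) unfolding feasible_def by blast
          show ?case
          proof (cases "x < arr_time (fst \<omega>) q")
            case True
            have "ennreal w \<le> ennreal (?D * x + 1 * x - real (Suc q + 1) * (1\<^sup>2 / 2))"
              using w by (rule ennreal_leI)
            also have "\<dots> \<le> area db (\<pi> \<omega>) T"
              using x transmissions_less_of_arr_time[OF S assms(2,3) _ True] elim
              by (intro area_ge[OF S assms(2,3)]) auto
            finally show ?thesis
              using True by simp
          qed simp
        qed
      qed
      finally show ?case .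
    qed
  qed
  then have "ennreal a + ennreal e \<le> avg_age db \<pi> + ennreal e"
    by (rule add_right_mono)
  moreover have "ennreal (1 / 2 + d + db) \<le> ennreal a + ennreal e"
    using \<eta>(3) by (intro order_trans[OF ennreal_leI ennreal_add_le]) (simp add: a_def)
  ultimately show "ennreal (1 / 2 + d + db) \<le> avg_age db \<pi> + ennreal e"
    by (rule order_trans[rotated])
qed

section \<open>Matching of the upper and lower bounds\<close>

theorem theorem4:
  fixes d db :: real
  assumes "0 < d" and "0 < db"
  shows "feasible d db (beu_policy d db)
       \<and> avg_age db (beu_policy d db) = ennreal (max (1/2 + d + db) (3/2 * (d + db)))
       \<and> rho d db = ennreal (max (1/2 + d + db) (3/2 * (d + db)))"
proof -
  let ?V = "ennreal (max (1/2 + d + db) (3/2 * (d + db)))"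
  have feasible: "feasible d db (beu_policy d db)"
    using assms by (rule feasible_beu)
  have lower: "?V \<le> avg_age db \<pi>" if "feasible d db \<pi>" for \<pi>
    using avg_age_ge_energy[OF that assms] avg_age_ge_service[OF that assms] by (simp add: max_def)
  \<comment> \<open>Half of the slot length is the larger of 1/2 and (d + db)/2, so the upper bound
    is the larger of the two lower bounds.\<close>
  have "d + db + max 1 (d + db) / 2 = max (1/2 + d + db) (3/2 * (d + db))"
    by (simp add: max_def)
  then have upper: "avg_age db (beu_policy d db) \<le> ?V"
    using avg_age_beu_le[OF assms] by simp
  have "rho d db = ?V"
    unfolding rho_def
  proof (rule antisym)
    show "(INF \<pi>\<in>{\<pi>. feasible d db \<pi>}. avg_age db \<pi>) \<le> ?V"
      using feasible upper by (intro INF_lower2[of "beu_policy d db"]) auto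
    show "?V \<le> (INF \<pi>\<in>{\<pi>. feasible d db \<pi>}. avg_age db \<pi>)"
      using lower by (intro INF_greatest) auto
  qed
  then show ?thesis
    using feasible upper lower[OF feasible] by (auto intro: antisym)
qed

end
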